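(* Let $X$ be a compact Hausdorff space, and let $G$ be a subset of $\mathrm{C}(X)$ containing the constant function $1$. Let $A$ be the function system in $\mathrm{C}(X)$ spanned by $G\cup G^*$ (i.e. the closed linear span of $G\cup G^*$), and suppose that $A$ generates $\mathrm{C}(X)$ as a C*-algebra. Then the following are equivalent: (1) $\partial_A X=X$. (2) $G$ is a Korovkin set. (3) For any compact Hausdorff space $Y$, any unital $*$-homomorphism $\pi:\mathrm{C}(X)\to\mathrm{C}(Y)$ and any net of positive linear maps $\phi_\lambda:\mathrm{C}(X)\to\mathrm{C}(Y)$ satisfying $\lim_\lambda\phi_\lambda(g)=\pi(g)$ (in norm) for all $g\in G$, it follows that $\lim_\lambda\phi_\lambda(f)=\pi(f)$ (in norm) for all $f\in\mathrm{C}(X)$.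
   Context: $\mathrm{C}(X)$ is the C*-algebra of continuous complex-valued functions on $X$ with the supremum norm; $G^*=\{\bar g: g\in G\}$. A (concrete) function system in $\mathrm{C}(X)$ is a unital self-adjoint (norm closed) linear subspace of $\mathrm{C}(X)$. Choquet boundary: let $K=S(A)$ be the state space of $A$, i.e. the set of unital positive linear functionals on $A$ with the weak-$*$ topology. Each $x\in X$ gives a state $\varepsilon_x|_A\in K$, $\varepsilon_x|_A(a)=a(x)$. The Choquet boundary $\partial_A X$ is the set of $x\in X$ such that $\varepsilon_x|_A$ is an extreme point of $K$. Korovkin set: a subset $G\subset\mathrm{C}(X)$ containing $1$ is a Korovkin set if whenever $(\phi_\lambda)_{\lambda\in\Lambda}$ is a net of positive linear maps $\phi_\lambda:\mathrm{C}(X)\to\mathrm{C}(X)$ satisfying $\lim_\lambda\|\phi_\lambda(g)-g\|=0$ for all $g\in G$, then $\lim_\lambda\|\phi_\lambda(f)-f\|=0$ for all $f\in\mathrm{C}(X)$. *)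

theory Defs
  imports "HOL-Analysis.Analysis" "HOL-Library.Nonpos_Ints"
begin

section \<open>The C*-algebra of continuous functions on a compact space\<close>

text \<open>For compact \<open>X\<close>, the points of the following metric space are the continuous complex
  functions on \<open>topspace X\<close>, made extensional (value \<open>undefined\<close> off \<open>topspace X\<close>) so that
  equality in the algebra is equality in HOL.  The metric is the supremum metric, so that the
  distance of \<open>f\<close> and \<open>g\<close> is the supremum norm of \<open>f - g\<close> (it is \<open>0\<close> if \<open>X\<close> is empty).\<close>

abbreviation C_metric :: "'a topology \<Rightarrow> ('a \<Rightarrow> complex) metric" where
  "C_metric X \<equiv> cfunspace X euclidean_metric"

definition C_fun :: "'a topology \<Rightarrow> ('a \<Rightarrow> complex) set" where
  "C_fun X = mspace (C_metric X)"

definition C_const :: "'a topology \<Rightarrow> complex \<Rightarrow> 'a \<Rightarrow> complex" where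
  "C_const X c = (\<lambda>x\<in>topspace X. c)"

definition C_add :: "'a topology \<Rightarrow> ('a \<Rightarrow> complex) \<Rightarrow> ('a \<Rightarrow> complex) \<Rightarrow> 'a \<Rightarrow> complex" where
  "C_add X f g = (\<lambda>x\<in>topspace X. f x + g x)"

definition C_scale :: "'a topology \<Rightarrow> complex \<Rightarrow> ('a \<Rightarrow> complex) \<Rightarrow> 'a \<Rightarrow> complex" where
  "C_scale X c f = (\<lambda>x\<in>topspace X. c * f x)"

definition C_mult :: "'a topology \<Rightarrow> ('a \<Rightarrow> complex) \<Rightarrow> ('a \<Rightarrow> complex) \<Rightarrow> 'a \<Rightarrow> complex" where
  "C_mult X f g = (\<lambda>x\<in>topspace X. f x * g x)"

definition C_star :: "'a topology \<Rightarrow> ('a \<Rightarrow> complex) \<Rightarrow> 'a \<Rightarrow> complex" where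
  "C_star X f = (\<lambda>x\<in>topspace X. cnj (f x))"

definition C_nonneg :: "'a topology \<Rightarrow> ('a \<Rightarrow> complex) \<Rightarrow> bool" where
  "C_nonneg X f \<longleftrightarrow> (\<forall>x\<in>topspace X. f x \<in> \<real>\<^sub>\<ge>\<^sub>0)"

lemma mem_C_fun_iff:
  assumes "compact_space X"
  shows "f \<in> C_fun X \<longleftrightarrow> f \<in> extensional (topspace X) \<and> continuous_map X euclidean f"
proof -
  have "Met_TC.mbounded (f ` topspace X)" if "continuous_map X euclidean f"
  proof -
    have "compactin euclidean (f ` topspace X)"
      using image_compactin[OF _ that] assms unfolding compact_space_def by blast
    then show ?thesis
      by (simp add: compact_imp_bounded)
  qed
  then show ?thesis
    by (auto simp: C_fun_def)
qed

section \<open>Function systems, states and the Choquet boundary\<close>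

definition lin_span :: "'a topology \<Rightarrow> ('a \<Rightarrow> complex) set \<Rightarrow> ('a \<Rightarrow> complex) set" where
  "lin_span X S = {(\<lambda>x\<in>topspace X. \<Sum>g\<in>T. c g * g x) | T c. finite T \<and> T \<subseteq> S}"

definition closed_lin_span :: "'a topology \<Rightarrow> ('a \<Rightarrow> complex) set \<Rightarrow> ('a \<Rightarrow> complex) set" where
  "closed_lin_span X S = mtopology_of (C_metric X) closure_of lin_span X S"

definition spanned_function_system ::
    "'a topology \<Rightarrow> ('a \<Rightarrow> complex) set \<Rightarrow> ('a \<Rightarrow> complex) set" where
  "spanned_function_system X G = closed_lin_span X (G \<union> C_star X ` G)"

definition cstar_subalgebra :: "'a topology \<Rightarrow> ('a \<Rightarrow> complex) set \<Rightarrow> bool" where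
  "cstar_subalgebra X B \<longleftrightarrow>
     B \<subseteq> C_fun X \<and> C_const X 0 \<in> B \<and>
     (\<forall>f\<in>B. \<forall>g\<in>B. C_add X f g \<in> B \<and> C_mult X f g \<in> B) \<and>
     (\<forall>f\<in>B. C_star X f \<in> B \<and> (\<forall>c. C_scale X c f \<in> B)) \<and>
     closedin (mtopology_of (C_metric X)) B"

definition generates_C :: "'a topology \<Rightarrow> ('a \<Rightarrow> complex) set \<Rightarrow> bool" where
  "generates_C X A \<longleftrightarrow> cstar_subalgebra X hull A = C_fun X"

text \<open>A functional on \<open>A\<close> is represented by its extensional version, so that two states are
  equal in HOL iff they agree on \<open>A\<close>.\<close>

definition state_space ::
    "'a topology \<Rightarrow> ('a \<Rightarrow> complex) set \<Rightarrow> (('a \<Rightarrow> complex) \<Rightarrow> complex) set" where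
  "state_space X A = {s \<in> extensional A.
     (\<forall>a\<in>A. \<forall>b\<in>A. s (C_add X a b) = s a + s b) \<and>
     (\<forall>c. \<forall>a\<in>A. s (C_scale X c a) = c * s a) \<and>
     (\<forall>a\<in>A. C_nonneg X a \<longrightarrow> s a \<in> \<real>\<^sub>\<ge>\<^sub>0) \<and>
     s (C_const X 1) = 1}"

text \<open>The library constant \<open>extreme_point_of\<close> requires a type of class \<open>real_vector\<close>, which
  functionals on \<open>A\<close> do not form; hence the explicit definition.\<close>

definition extreme_state ::
    "'a topology \<Rightarrow> ('a \<Rightarrow> complex) set \<Rightarrow> (('a \<Rightarrow> complex) \<Rightarrow> complex) \<Rightarrow> bool" where
  "extreme_state X A s \<longleftrightarrow> s \<in> state_space X A \<and>
     (\<forall>t\<in>state_space X A. \<forall>u\<in>state_space X A. \<forall>r::real.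
        0 < r \<and> r < 1 \<and> s = (\<lambda>a\<in>A. of_real r * t a + of_real (1 - r) * u a) \<longrightarrow> t = s \<and> u = s)"

definition point_state :: "('a \<Rightarrow> complex) set \<Rightarrow> 'a \<Rightarrow> ('a \<Rightarrow> complex) \<Rightarrow> complex" where
  "point_state A x = (\<lambda>a\<in>A. a x)"

definition choquet_boundary :: "'a topology \<Rightarrow> ('a \<Rightarrow> complex) set \<Rightarrow> 'a set" where
  "choquet_boundary X A = {x \<in> topspace X. extreme_state X A (point_state A x)}"

section \<open>Maps between function algebras\<close>

definition linear_C ::
    "'a topology \<Rightarrow> 'b topology \<Rightarrow> (('a \<Rightarrow> complex) \<Rightarrow> ('b \<Rightarrow> complex)) \<Rightarrow> bool" where
  "linear_C X Y \<phi> \<longleftrightarrow> \<phi> \<in> C_fun X \<rightarrow> C_fun Y \<and>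
     (\<forall>f\<in>C_fun X. \<forall>g\<in>C_fun X. \<phi> (C_add X f g) = C_add Y (\<phi> f) (\<phi> g)) \<and>
     (\<forall>c. \<forall>f\<in>C_fun X. \<phi> (C_scale X c f) = C_scale Y c (\<phi> f))"

definition positive_linear_C ::
    "'a topology \<Rightarrow> 'b topology \<Rightarrow> (('a \<Rightarrow> complex) \<Rightarrow> ('b \<Rightarrow> complex)) \<Rightarrow> bool" where
  "positive_linear_C X Y \<phi> \<longleftrightarrow> linear_C X Y \<phi> \<and>
     (\<forall>f\<in>C_fun X. C_nonneg X f \<longrightarrow> C_nonneg Y (\<phi> f))"

definition unital_star_hom ::
    "'a topology \<Rightarrow> 'b topology \<Rightarrow> (('a \<Rightarrow> complex) \<Rightarrow> ('b \<Rightarrow> complex)) \<Rightarrow> bool" where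
  "unital_star_hom X Y \<pi> \<longleftrightarrow> linear_C X Y \<pi> \<and>
     (\<forall>f\<in>C_fun X. \<forall>g\<in>C_fun X. \<pi> (C_mult X f g) = C_mult Y (\<pi> f) (\<pi> g)) \<and>
     (\<forall>f\<in>C_fun X. \<pi> (C_star X f) = C_star Y (\<pi> f)) \<and>
     \<pi> (C_const X 1) = C_const Y 1"

section \<open>Nets of positive maps and Korovkin sets\<close>

definition directed_set :: "'i set \<Rightarrow> ('i \<Rightarrow> 'i \<Rightarrow> bool) \<Rightarrow> bool" where
  "directed_set \<Lambda> le \<longleftrightarrow> \<Lambda> \<noteq> {} \<and> reflp_on \<Lambda> le \<and> transp_on \<Lambda> le \<and>
     (\<forall>i\<in>\<Lambda>. \<forall>j\<in>\<Lambda>. \<exists>k\<in>\<Lambda>. le i k \<and> le j k)"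

definition net_filter :: "'i set \<Rightarrow> ('i \<Rightarrow> 'i \<Rightarrow> bool) \<Rightarrow> 'i filter" where
  "net_filter \<Lambda> le = (INF i\<in>\<Lambda>. principal {j\<in>\<Lambda>. le i j})"

lemma eventually_net_filter:
  assumes "directed_set \<Lambda> le"
  shows "eventually P (net_filter \<Lambda> le) \<longleftrightarrow> (\<exists>i\<in>\<Lambda>. \<forall>j\<in>\<Lambda>. le i j \<longrightarrow> P j)"
proof -
  have "\<exists>k\<in>\<Lambda>. principal {l \<in> \<Lambda>. le k l} \<le> inf (principal {l \<in> \<Lambda>. le i l}) (principal {l \<in> \<Lambda>. le j l})"
    if "i \<in> \<Lambda>" "j \<in> \<Lambda>" for i j
  proof -
    obtain k where "k \<in> \<Lambda>" "le i k" "le j k"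
      using assms \<open>i \<in> \<Lambda>\<close> \<open>j \<in> \<Lambda>\<close> unfolding directed_set_def by blast
    moreover have "transp_on \<Lambda> le" using assms by (simp add: directed_set_def)
    ultimately show ?thesis
      using that by (intro bexI[of _ k]) (auto dest: transp_onD)
  qed
  moreover have "\<Lambda> \<noteq> {}" using assms by (simp add: directed_set_def)
  ultimately have "eventually P (net_filter \<Lambda> le) \<longleftrightarrow>
      (\<exists>i\<in>\<Lambda>. eventually P (principal {j\<in>\<Lambda>. le i j}))"
    unfolding net_filter_def by (intro eventually_INF_base) auto
  then show ?thesis by (auto simp: eventually_principal)
qed

text \<open>A definition cannot quantify over the type of the indices of a net.  The index type
  chosen here, pairs of a map and a set of maps, is large enough to lose no generality: by
  \<open>net_determined_any_index\<close> below, the property then holds for nets over every index type.\<close>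

definition net_determined ::
    "'a topology \<Rightarrow> 'b topology \<Rightarrow> (('a \<Rightarrow> complex) \<Rightarrow> ('b \<Rightarrow> complex)) \<Rightarrow>
     ('a \<Rightarrow> complex) set \<Rightarrow> bool" where
  "net_determined X Y \<pi> G \<longleftrightarrow>
     (\<forall>(\<Lambda> :: ((('a \<Rightarrow> complex) \<Rightarrow> ('b \<Rightarrow> complex)) \<times> (('a \<Rightarrow> complex) \<Rightarrow> ('b \<Rightarrow> complex)) set) set) le \<phi>.
        directed_set \<Lambda> le \<and> (\<forall>i\<in>\<Lambda>. positive_linear_C X Y (\<phi> i)) \<and>
        (\<forall>g\<in>G. ((\<lambda>i. mdist (C_metric Y) (\<phi> i g) (\<pi> g)) \<longlongrightarrow> 0) (net_filter \<Lambda> le)) \<longrightarrow>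
        (\<forall>f\<in>C_fun X. ((\<lambda>i. mdist (C_metric Y) (\<phi> i f) (\<pi> f)) \<longlongrightarrow> 0) (net_filter \<Lambda> le)))"

lemma net_determined_any_index:
  fixes \<Lambda> :: "'i set" and \<phi> :: "'i \<Rightarrow> ('a \<Rightarrow> complex) \<Rightarrow> ('b \<Rightarrow> complex)"
  assumes det: "net_determined X Y \<pi> G"
    and dir: "directed_set \<Lambda> le"
    and pos: "\<And>i. i \<in> \<Lambda> \<Longrightarrow> positive_linear_C X Y (\<phi> i)"
    and conv: "\<And>g. g \<in> G \<Longrightarrow> ((\<lambda>i. mdist (C_metric Y) (\<phi> i g) (\<pi> g)) \<longlongrightarrow> 0) (net_filter \<Lambda> le)"
    and "f \<in> C_fun X"
  shows "((\<lambda>i. mdist (C_metric Y) (\<phi> i f) (\<pi> f)) \<longlongrightarrow> 0) (net_filter \<Lambda> le)"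
proof -
  define tl where "tl i = \<phi> ` {k\<in>\<Lambda>. le i k}" for i
  define \<Lambda>' where "\<Lambda>' = {(\<phi> j, tl i) | i j. i \<in> \<Lambda> \<and> j \<in> \<Lambda> \<and> le i j}"
  define le' where "le' p q \<longleftrightarrow> snd q \<subseteq> snd p"
    for p q :: "(('a \<Rightarrow> complex) \<Rightarrow> ('b \<Rightarrow> complex)) \<times> (('a \<Rightarrow> complex) \<Rightarrow> ('b \<Rightarrow> complex)) set"
  have refl: "le i i" if "i \<in> \<Lambda>" for i
    using dir that by (auto simp: directed_set_def dest: reflp_onD)
  have trans: "le i k" if "le i j" "le j k" "i \<in> \<Lambda>" "j \<in> \<Lambda>" "k \<in> \<Lambda>" for i j k
    using dir that unfolding directed_set_def by (metis transp_onD)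
  have dir': "directed_set \<Lambda>' le'"
    unfolding directed_set_def
  proof (intro conjI ballI)
    obtain i where "i \<in> \<Lambda>" using dir by (auto simp: directed_set_def)
    then show "\<Lambda>' \<noteq> {}" using refl by (auto simp: \<Lambda>'_def)
    show "reflp_on \<Lambda>' le'" "transp_on \<Lambda>' le'"
      by (auto simp: le'_def intro!: reflp_onI transp_onI)
    fix p q assume "p \<in> \<Lambda>'" "q \<in> \<Lambda>'"
    then obtain i j where ij: "i \<in> \<Lambda>" "j \<in> \<Lambda>" "snd p = tl i" "snd q = tl j"
      by (auto simp: \<Lambda>'_def)
    obtain k where k: "k \<in> \<Lambda>" "le i k" "le j k"
      using dir ij unfolding directed_set_def by blast
    have "tl k \<subseteq> tl i" "tl k \<subseteq> tl j"
      unfolding tl_def using k ij trans by blast+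
    moreover have "(\<phi> k, tl k) \<in> \<Lambda>'" using k refl by (auto simp: \<Lambda>'_def)
    ultimately show "\<exists>r\<in>\<Lambda>'. le' p r \<and> le' q r"
      using ij by (intro bexI[of _ "(\<phi> k, tl k)"]) (auto simp: le'_def)
  qed
  have ev: "eventually (\<lambda>p. Q (fst p)) (net_filter \<Lambda>' le') \<longleftrightarrow>
        eventually (\<lambda>i. Q (\<phi> i)) (net_filter \<Lambda> le)" for Q
  proof
    assume "eventually (\<lambda>p. Q (fst p)) (net_filter \<Lambda>' le')"
    then obtain p where p: "p \<in> \<Lambda>'" "\<And>q. q \<in> \<Lambda>' \<Longrightarrow> le' p q \<Longrightarrow> Q (fst q)"
      unfolding eventually_net_filter[OF dir'] by blast
    from p(1) obtain i where i: "i \<in> \<Lambda>" "snd p = tl i" by (auto simp: \<Lambda>'_def)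
    have "Q (\<phi> j)" if "j \<in> \<Lambda>" "le i j" for j
      using p(2)[of "(\<phi> j, tl i)"] that i by (auto simp: \<Lambda>'_def le'_def)
    with i show "eventually (\<lambda>i. Q (\<phi> i)) (net_filter \<Lambda> le)"
      unfolding eventually_net_filter[OF dir] by blast
  next
    assume "eventually (\<lambda>i. Q (\<phi> i)) (net_filter \<Lambda> le)"
    then obtain i where i: "i \<in> \<Lambda>" "\<And>j. j \<in> \<Lambda> \<Longrightarrow> le i j \<Longrightarrow> Q (\<phi> j)"
      unfolding eventually_net_filter[OF dir] by blast
    have mem: "(\<phi> i, tl i) \<in> \<Lambda>'" using i refl by (auto simp: \<Lambda>'_def)
    have "Q (fst q)" if "q \<in> \<Lambda>'" "le' (\<phi> i, tl i) q" for q
    proof -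
      have "fst q \<in> snd q" using that(1) by (auto simp: \<Lambda>'_def tl_def)
      then have "fst q \<in> tl i" using that(2) by (auto simp: le'_def)
      then show ?thesis using i(2) by (auto simp: tl_def)
    qed
    with mem show "eventually (\<lambda>p. Q (fst p)) (net_filter \<Lambda>' le')"
      unfolding eventually_net_filter[OF dir'] by blast
  qed
  have lim: "((\<lambda>p. mdist (C_metric Y) (fst p h) (\<pi> h)) \<longlongrightarrow> 0) (net_filter \<Lambda>' le') \<longleftrightarrow>
        ((\<lambda>i. mdist (C_metric Y) (\<phi> i h) (\<pi> h)) \<longlongrightarrow> 0) (net_filter \<Lambda> le)" for h
    unfolding tendsto_iff using ev[of "\<lambda>\<psi>. dist (mdist (C_metric Y) (\<psi> h) (\<pi> h)) 0 < _"] by simp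
  have pos': "\<forall>p\<in>\<Lambda>'. positive_linear_C X Y (fst p)"
    using pos by (auto simp: \<Lambda>'_def)
  have "\<forall>g\<in>G. ((\<lambda>p. mdist (C_metric Y) (fst p g) (\<pi> g)) \<longlongrightarrow> 0) (net_filter \<Lambda>' le')"
    using conv lim by blast
  then have "((\<lambda>p. mdist (C_metric Y) (fst p f) (\<pi> f)) \<longlongrightarrow> 0) (net_filter \<Lambda>' le')"
    using det[unfolded net_determined_def, rule_format, of \<Lambda>' le' fst] dir' pos' \<open>f \<in> C_fun X\<close> by blast
  then show ?thesis using lim by blast
qed

definition korovkin_set :: "'a topology \<Rightarrow> ('a \<Rightarrow> complex) set \<Rightarrow> bool" where
  "korovkin_set X G \<longleftrightarrow> G \<subseteq> C_fun X \<and> C_const X 1 \<in> G \<and> net_determined X X (\<lambda>f. f) G"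

end

theory Submission
  imports Defs
begin

text \<open>All three conditions are equivalent to a fourth one: for every point \<open>x\<close>, evaluation at \<open>x\<close> is the only
  state of \<open>C(X)\<close> that extends its own restriction to \<open>A\<close> (\<open>unique_extension\<close>).

  For a single point this is membership in the Choquet boundary.  If the restriction is extreme and \<open>T\<close> is an
  extension, then splitting \<open>T\<close> as \<open>T (k \<cdot>) + T ((1 - k) \<cdot>)\<close> for weights \<open>0 < k < 1\<close> shows
  \<open>T (h a) = T h a(x)\<close> for \<open>a \<in> A\<close>.  The elements \<open>a\<close> with this property form a C*-subalgebra, which is everything
  because \<open>A\<close> generates (\<open>choquet_boundary_imp_unique_extension\<close>).  Conversely, states of \<open>A\<close> extend to \<open>C(X)\<close>,
  so a decomposition of the point state lifts to a decomposition of evaluation at \<open>x\<close> on \<open>C(X)\<close>, where it is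
  trivial (\<open>unique_extension_imp_choquet_boundary\<close>).

  Uniqueness implies convergence by a squeezing argument that uses no subnets.  The extension theorem for
  states (\<open>state_extension\<close>) produces an extension whose value at a given real \<open>f\<close> is the infimum of \<open>a(x)\<close>
  over \<open>a \<ge> f\<close> in the function system; if the extension is unique, this infimum is \<open>f(x)\<close>.  So near each
  point \<open>f\<close> is caught between two elements of the linear span of \<open>G \<union> G*\<close> that almost agree there.  Finitely
  many such pairs cover \<open>X\<close>, positive maps preserve the inequalities, and unital *-homomorphisms out of
  \<open>C(X)\<close> are pointwise evaluations (\<open>star_hom_point_evaluation\<close>), so convergence on the span forces
  uniform convergence at \<open>f\<close> (\<open>limit_set_eq_C_fun\<close>).

  Convergence implies uniqueness because a second extension \<open>T\<close> produces a net that converges on \<open>G\<close> but not everywhere.  For \<open>Y = X\<close> it is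
  the net that replaces \<open>f\<close> by the constant \<open>T f\<close> near \<open>x\<close>, using bump functions supported in smaller and
  smaller neighbourhoods (\<open>net_determined_identity_imp_unique_extension\<close>); for a one-point \<open>Y\<close> it is \<open>T\<close> itself
  (\<open>net_determined_point_imp_unique_extension\<close>).\<close>

section \<open>Linear functionals below a sublinear one\<close>

locale real_function_space =
  fixes E :: "('a \<Rightarrow> real) set"
  assumes zero_mem: "(\<lambda>x. 0) \<in> E"
    and add_mem: "f \<in> E \<Longrightarrow> g \<in> E \<Longrightarrow> (\<lambda>x. f x + g x) \<in> E"
    and scale_mem: "f \<in> E \<Longrightarrow> (\<lambda>x. c * f x) \<in> E"
begin

lemma uminus_mem: "f \<in> E \<Longrightarrow> (\<lambda>x. - f x) \<in> E"
  using scale_mem[of f "-1"] by simp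

definition sublinear :: "(('a \<Rightarrow> real) \<Rightarrow> real) \<Rightarrow> bool" where
  "sublinear q \<longleftrightarrow> (\<forall>f\<in>E. \<forall>g\<in>E. q (\<lambda>x. f x + g x) \<le> q f + q g) \<and>
     (\<forall>f\<in>E. \<forall>c\<ge>0. q (\<lambda>x. c * f x) = c * q f)"

definition linear_functional :: "(('a \<Rightarrow> real) \<Rightarrow> real) \<Rightarrow> bool" where
  "linear_functional F \<longleftrightarrow> (\<forall>f\<in>E. \<forall>g\<in>E. F (\<lambda>x. f x + g x) = F f + F g) \<and>
     (\<forall>f\<in>E. \<forall>c. F (\<lambda>x. c * f x) = c * F f)"

lemma sublinear_add: "sublinear q \<Longrightarrow> f \<in> E \<Longrightarrow> g \<in> E \<Longrightarrow> q (\<lambda>x. f x + g x) \<le> q f + q g"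
  and sublinear_scale: "sublinear q \<Longrightarrow> f \<in> E \<Longrightarrow> 0 \<le> c \<Longrightarrow> q (\<lambda>x. c * f x) = c * q f"
  by (auto simp: sublinear_def)

lemma sublinear_zero: "sublinear q \<Longrightarrow> q (\<lambda>x. 0) = 0"
  using sublinear_scale[OF _ zero_mem, of q 0] by simp

lemma sublinear_lower: "sublinear q \<Longrightarrow> f \<in> E \<Longrightarrow> - q (\<lambda>x. - f x) \<le> q f"
  using sublinear_add[OF _ _ uminus_mem, of q f f] sublinear_zero[of q] by simp

lemma sublinearI:
  assumes add: "\<And>f g. f \<in> E \<Longrightarrow> g \<in> E \<Longrightarrow> q (\<lambda>x. f x + g x) \<le> q f + q g"
    and zero: "q (\<lambda>x. 0) = 0"
    and scale: "\<And>f c. f \<in> E \<Longrightarrow> 0 < c \<Longrightarrow> q (\<lambda>x. c * f x) \<le> c * q f"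
  shows "sublinear q"
proof -
  have "q (\<lambda>x. c * f x) = c * q f" if f: "f \<in> E" and c: "0 \<le> c" for f c
  proof (cases "c = 0")
    case True
    then show ?thesis using zero by simp
  next
    case False
    with c have c: "0 < c" by simp
    have "q (\<lambda>x. inverse c * (c * f x)) \<le> inverse c * q (\<lambda>x. c * f x)"
      using c by (intro scale scale_mem f) auto
    moreover have "(\<lambda>x. inverse c * (c * f x)) = f" using c by auto
    ultimately have "c * q f \<le> q (\<lambda>x. c * f x)"
      using c by (simp add: field_simps)
    with scale[OF f c] show ?thesis by simp
  qed
  then show ?thesis using add by (simp add: sublinear_def)
qed

text \<open>The functional \<open>q'\<close> is the largest sublinear functional below \<open>q\<close> with \<open>q' (- h) \<le> - q h\<close>, that is, the
  result of making \<open>q\<close> linear in the direction \<open>h\<close>.  Explicitly, \<open>q' f\<close> is the infimum of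
  \<open>q (f + s h) - s q h\<close> over \<open>s \<ge> 0\<close>; the values at \<open>s = 0\<close> and \<open>s = 1\<close> give the two upper bounds.\<close>

lemma sublinear_tilt:
  assumes q: "sublinear q" and h: "h \<in> E"
  obtains q' where "sublinear q'" "\<And>f. f \<in> E \<Longrightarrow> q' f \<le> q f"
    "\<And>f. f \<in> E \<Longrightarrow> q' f \<le> q (\<lambda>x. f x + h x) - q h"
proof -
  define v where "v f s = q (\<lambda>x. f x + s * h x) - s * q h" for f s
  define q' where "q' f = (INF s\<in>{0..}. v f s)" for f
  have lower: "- q (\<lambda>x. - f x) \<le> v f s" if "f \<in> E" "0 \<le> s" for f s
  proof -
    have "q (\<lambda>x. (f x + s * h x) + - f x) \<le> q (\<lambda>x. f x + s * h x) + q (\<lambda>x. - f x)"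
      using that h by (intro sublinear_add[OF q] add_mem scale_mem uminus_mem)
    then show ?thesis
      using sublinear_scale[OF q h \<open>0 \<le> s\<close>] by (simp add: v_def)
  qed
  have q'_le: "q' f \<le> v f s" if "f \<in> E" "0 \<le> s" for f s
    unfolding q'_def using that
    by (intro cINF_lower bdd_belowI2[of _ "- q (\<lambda>x. - f x)"] lower) auto
  have le_q': "c \<le> q' f" if "\<And>s. 0 \<le> s \<Longrightarrow> c \<le> v f s" for c f
    unfolding q'_def using that by (intro cINF_greatest) auto
  have "sublinear q'"
  proof (rule sublinearI)
    have "v (\<lambda>x. 0) s = 0" if "0 \<le> s" for s
      using sublinear_scale[OF q h that] by (simp add: v_def)
    then show "q' (\<lambda>x. 0) = 0" using q'_le[OF zero_mem, of 0] le_q'[of 0 "\<lambda>x. 0"] by simp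
  next
    fix f c assume f: "f \<in> E" and c: "(0::real) < c"
    have "q' (\<lambda>x. c * f x) / c \<le> v f s" if s: "0 \<le> s" for s
    proof -
      have "q' (\<lambda>x. c * f x) \<le> v (\<lambda>x. c * f x) (c * s)"
        using f c s by (intro q'_le scale_mem) auto
      also have "\<dots> = c * v f s"
        using sublinear_scale[OF q add_mem[OF f scale_mem[OF h, of s]], of c] c
        by (simp add: v_def algebra_simps)
      finally show ?thesis using c by (simp add: field_simps)
    qed
    then have "q' (\<lambda>x. c * f x) / c \<le> q' f" by (rule le_q')
    then show "q' (\<lambda>x. c * f x) \<le> c * q' f" using c by (simp add: field_simps)
  next
    fix f g assume f: "f \<in> E" and g: "g \<in> E"
    have "q' (\<lambda>x. f x + g x) - v f s \<le> v g t" if s: "0 \<le> s" and t: "0 \<le> t" for s t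
    proof -
      have "q' (\<lambda>x. f x + g x) \<le> v (\<lambda>x. f x + g x) (s + t)"
        using f g s t by (intro q'_le add_mem) auto
      also have "\<dots> \<le> v f s + v g t"
        using sublinear_add[OF q add_mem[OF f scale_mem[OF h, of s]] add_mem[OF g scale_mem[OF h, of t]]]
        by (simp add: v_def algebra_simps)
      finally show ?thesis by simp
    qed
    then have "q' (\<lambda>x. f x + g x) - v f s \<le> q' g" if "0 \<le> s" for s
      using that by (intro le_q') auto
    then have "q' (\<lambda>x. f x + g x) - q' g \<le> q' f"
      by (intro le_q') (auto simp: algebra_simps)
    then show "q' (\<lambda>x. f x + g x) \<le> q' f + q' g" by simp
  qed
  then show thesis
    using q'_le[of _ 0] q'_le[of _ 1] by (intro that) (auto simp: v_def)
qed

text \<open>Zorn's lemma for the pointwise order: the infimum of a chain of sublinear functionals below \<open>p\<close> is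
  finite, because \<open>q f \<ge> - q (- f) \<ge> - p (- f)\<close>, and subadditive, because two members of a chain have a
  smaller one in common.  Using functionals defined on all of \<open>E\<close> avoids the partial extensions, and the
  graphs, of the usual argument.\<close>

lemma minimal_sublinear:
  assumes p: "sublinear p"
  obtains m where "sublinear m" "\<And>f. f \<in> E \<Longrightarrow> m f \<le> p f"
    "\<And>q f. sublinear q \<Longrightarrow> (\<And>f. f \<in> E \<Longrightarrow> q f \<le> m f) \<Longrightarrow> f \<in> E \<Longrightarrow> q f = m f"
proof -
  \<comment> \<open>A functional has arbitrary values off \<open>E\<close>; setting them to \<open>0\<close> makes the pointwise order antisymmetric.\<close>
  define on_E where "on_E q f = (if f \<in> E then q f else 0)" for q :: "('a \<Rightarrow> real) \<Rightarrow> real" and f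
  have on_E: "sublinear (on_E q)" if "sublinear q" for q
    using that by (auto simp: on_E_def sublinear_def add_mem scale_mem)
  define S where "S = {q. sublinear q \<and> (\<forall>f\<in>E. q f \<le> p f) \<and> (\<forall>f. f \<notin> E \<longrightarrow> q f = 0)}"
  have "\<exists>m\<in>S. \<forall>q\<in>S. m \<ge> q \<longrightarrow> q = m"
  proof (rule predicate_Zorn)
    show "partial_order_on S (relation_of (\<ge>) S)"
      by (rule partial_order_on_relation_ofI) auto
  next
    fix C assume C: "C \<in> Chains (relation_of (\<ge>) S)"
    have CS: "q \<in> S" if "q \<in> C" for q
      using C that by (auto simp: Chains_def relation_of_def)
    have chain: "q \<le> r \<or> r \<le> q" if "q \<in> C" "r \<in> C" for q r
      using C that by (auto simp: Chains_def relation_of_def)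
    show "\<exists>u\<in>S. \<forall>q\<in>C. q \<ge> u"
    proof (cases "C = {}")
      case True
      have "on_E p \<in> S" using p on_E by (auto simp: S_def on_E_def)
      then show ?thesis using True by blast
    next
      case False
      define u where "u f = (INF q\<in>C. q f)" for f
      have lower: "- p (\<lambda>x. - f x) \<le> q f" if "q \<in> C" "f \<in> E" for q f
        using CS[OF that(1)] sublinear_lower[of q f] uminus_mem[of f] that(2)
        by (force simp: S_def)
      have bdd: "bdd_below ((\<lambda>q. q f) ` C)" for f
      proof (cases "f \<in> E")
        case True
        then show ?thesis by (intro bdd_belowI2[of _ "- p (\<lambda>x. - f x)"] lower) auto
      next
        case False
        then have "q f = 0" if "q \<in> C" for q using CS[OF that] by (simp add: S_def)
        then show ?thesis by (intro bdd_belowI2[of C 0]) (metis order_refl)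
      qed
      have u_le: "u f \<le> q f" if "q \<in> C" for q f
        unfolding u_def using bdd that by (intro cINF_lower) auto
      have le_u: "c \<le> u f" if "\<And>q. q \<in> C \<Longrightarrow> c \<le> q f" for c f
        unfolding u_def using that False by (intro cINF_greatest) auto
      have sub: "sublinear q" if "q \<in> C" for q using CS[OF that] by (simp add: S_def)
      obtain q0 where q0: "q0 \<in> C" using False by blast
      have "sublinear u"
      proof (rule sublinearI)
        have "q (\<lambda>x. 0) = 0" if "q \<in> C" for q
          using sublinear_zero[OF sub[OF that]] .
        then show "u (\<lambda>x. 0) = 0" using u_le[OF q0, of "\<lambda>x. 0"] q0 le_u[of 0 "\<lambda>x. 0"] by force
      next
        fix f c assume f: "f \<in> E" and c: "(0::real) < c"
        have "u (\<lambda>x. c * f x) / c \<le> q f" if q: "q \<in> C" for q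
          using u_le[OF q, of "\<lambda>x. c * f x"] sublinear_scale[OF sub[OF q] f, of c] c
          by (simp add: field_simps)
        then have "u (\<lambda>x. c * f x) / c \<le> u f" by (rule le_u)
        then show "u (\<lambda>x. c * f x) \<le> c * u f" using c by (simp add: field_simps)
      next
        fix f g assume f: "f \<in> E" and g: "g \<in> E"
        have "u (\<lambda>x. f x + g x) - q f \<le> r g" if q: "q \<in> C" and r: "r \<in> C" for q r
        proof -
          obtain m where m: "m \<in> C" "m \<le> q" "m \<le> r" using chain[OF q r] q r by blast
          have "u (\<lambda>x. f x + g x) \<le> m f + m g"
            using u_le[OF m(1)] sublinear_add[OF sub[OF m(1)] f g] by (rule order_trans)
          also have "\<dots> \<le> q f + r g" using m(2,3) by (intro add_mono) (auto simp: le_fun_def)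
          finally show ?thesis by simp
        qed
        then have "u (\<lambda>x. f x + g x) - q f \<le> u g" if "q \<in> C" for q
          using that by (intro le_u) auto
        then have "u (\<lambda>x. f x + g x) - u g \<le> u f" by (intro le_u) (auto simp: algebra_simps)
        then show "u (\<lambda>x. f x + g x) \<le> u f + u g" by simp
      qed
      moreover have "u f \<le> p f" if "f \<in> E" for f
        using u_le[OF q0, of f] CS[OF q0] that by (force simp: S_def)
      moreover have "u f = 0" if "f \<notin> E" for f
      proof -
        have "(\<lambda>q. q f) ` C = {0}" using CS that q0 by (force simp: S_def)
        then show ?thesis by (simp add: u_def)
      qed
      ultimately have "u \<in> S" by (simp add: S_def)
      then show ?thesis using u_le by (auto simp: le_fun_def)
    qed
  qed
  then obtain m where m: "m \<in> S" "\<And>q. q \<in> S \<Longrightarrow> q \<le> m \<Longrightarrow> q = m" by blast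
  show thesis
  proof (rule that)
    show "m f \<le> p f" if "f \<in> E" for f using m(1) that by (auto simp: S_def)
    fix q f assume q: "sublinear q" "\<And>f. f \<in> E \<Longrightarrow> q f \<le> m f" and f: "f \<in> E"
    have "q f \<le> p f" if "f \<in> E" for f
      using q(2)[OF that] m(1) that by (force simp: S_def)
    then have "on_E q \<in> S" using on_E[OF q(1)] by (auto simp: S_def on_E_def)
    moreover have "on_E q \<le> m" using q(2) m(1) by (auto simp: S_def on_E_def le_fun_def)
    ultimately have "on_E q = m" by (rule m(2))
    then show "q f = m f" using f by (auto simp: on_E_def)
  next
    show "sublinear m" using m(1) by (auto simp: S_def)
  qed
qed

text \<open>A minimal sublinear functional \<open>m\<close> is linear: tilting it in the direction \<open>g\<close> yields a functional below \<open>m\<close>,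
  hence \<open>m\<close> itself, and the second bound of the tilt becomes \<open>m f + m g \<le> m (f + g)\<close>.
  Tilting \<open>p\<close> in the direction \<open>h\<close> before minimising makes the bound attained at \<open>h\<close>.  This exact value at a
  prescribed point is what turns uniqueness of extensions into one-sided approximation later on.\<close>

theorem hahn_banach:
  assumes p: "sublinear p" and h: "h \<in> E"
  obtains F where "linear_functional F" "\<And>f. f \<in> E \<Longrightarrow> F f \<le> p f" "F h = p h"
proof -
  obtain p' where p': "sublinear p'" "\<And>f. f \<in> E \<Longrightarrow> p' f \<le> p f"
    "\<And>f. f \<in> E \<Longrightarrow> p' f \<le> p (\<lambda>x. f x + h x) - p h"
    using sublinear_tilt[OF p h] by blast
  obtain m where m: "sublinear m" "\<And>f. f \<in> E \<Longrightarrow> m f \<le> p' f"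
    and min: "\<And>q f. sublinear q \<Longrightarrow> (\<And>f. f \<in> E \<Longrightarrow> q f \<le> m f) \<Longrightarrow> f \<in> E \<Longrightarrow> q f = m f"
    using minimal_sublinear[OF p'(1)] by blast
  have add: "m (\<lambda>x. f x + g x) = m f + m g" if f: "f \<in> E" and g: "g \<in> E" for f g
  proof -
    obtain q where q: "sublinear q" "\<And>f. f \<in> E \<Longrightarrow> q f \<le> m f"
      "\<And>f. f \<in> E \<Longrightarrow> q f \<le> m (\<lambda>x. f x + g x) - m g"
      using sublinear_tilt[OF m(1) g] by blast
    have "q f = m f" using q(1,2) f by (rule min)
    with q(3)[OF f] sublinear_add[OF m(1) f g] show ?thesis by simp
  qed
  have neg: "m (\<lambda>x. - f x) = - m f" if "f \<in> E" for f
    using add[OF that uminus_mem[OF that]] sublinear_zero[OF m(1)] by simp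
  have scale: "m (\<lambda>x. c * f x) = c * m f" if f: "f \<in> E" for f c
  proof (cases "0 \<le> c")
    case False
    then show ?thesis
      using neg[OF scale_mem[OF f, of "- c"]] sublinear_scale[OF m(1) f, of "- c"] by simp
  qed (rule sublinear_scale[OF m(1) f])
  have le: "m f \<le> p f" if "f \<in> E" for f
    using m(2)[OF that] p'(2)[OF that] by simp
  have "m (\<lambda>x. - h x) \<le> - p h"
    using m(2)[OF uminus_mem[OF h]] p'(3)[OF uminus_mem[OF h]] sublinear_zero[OF p] by simp
  then have "m h = p h" using neg[OF h] le[OF h] by simp
  then show thesis using add scale le by (intro that[of m]) (auto simp: linear_functional_def)
qed

end

section \<open>Pointwise operations on continuous functions\<close>

definition C_real :: "'a topology \<Rightarrow> ('a \<Rightarrow> real) \<Rightarrow> 'a \<Rightarrow> complex" where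
  "C_real X r = (\<lambda>x\<in>topspace X. complex_of_real (r x))"

lemma C_apply:
  assumes "x \<in> topspace X"
  shows "C_const X c x = c" "C_add X f g x = f x + g x" "C_scale X c f x = c * f x"
    "C_mult X f g x = f x * g x" "C_star X f x = cnj (f x)" "C_real X r x = of_real (r x)"
  using assms by (auto simp: C_const_def C_add_def C_scale_def C_mult_def C_star_def C_real_def)

lemma C_extensional [simp]:
  "C_const X c \<in> extensional (topspace X)" "C_add X f g \<in> extensional (topspace X)"
  "C_scale X c f \<in> extensional (topspace X)" "C_mult X f g \<in> extensional (topspace X)"
  "C_star X f \<in> extensional (topspace X)" "C_real X r \<in> extensional (topspace X)"
  by (auto simp: C_const_def C_add_def C_scale_def C_mult_def C_star_def C_real_def)

lemma C_eqI:
  assumes "f \<in> extensional (topspace X)" "g \<in> extensional (topspace X)"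
    "\<And>x. x \<in> topspace X \<Longrightarrow> f x = g x"
  shows "f = g"
  using assms by (rule extensionalityI)

lemma C_real_cong: "(\<And>x. x \<in> topspace X \<Longrightarrow> r x = s x) \<Longrightarrow> C_real X r = C_real X s"
  by (auto simp: C_real_def fun_eq_iff)

lemma C_real_add: "C_add X (C_real X r) (C_real X s) = C_real X (\<lambda>x. r x + s x)"
  by (rule C_eqI[of _ X]) (auto simp: C_apply)

lemma C_real_scale: "C_scale X (of_real c) (C_real X r) = C_real X (\<lambda>x. c * r x)"
  by (rule C_eqI[of _ X]) (auto simp: C_apply)

lemma C_real_const: "C_const X (of_real c) = C_real X (\<lambda>x. c)"
  by (rule C_eqI[of _ X]) (auto simp: C_apply)

lemma C_const_scale: "C_const X c = C_scale X c (C_const X 1)"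
  by (rule C_eqI[of _ X]) (auto simp: C_apply)

lemma C_decompose:
  assumes "f \<in> extensional (topspace X)"
  shows "f = C_add X (C_real X (\<lambda>x. Re (f x))) (C_scale X \<i> (C_real X (\<lambda>x. Im (f x))))"
  using assms by (intro C_eqI[of _ X]) (auto simp: C_apply complex_eq_iff)

lemma C_nonneg_real [simp]: "C_nonneg X (C_real X r) \<longleftrightarrow> (\<forall>x\<in>topspace X. 0 \<le> r x)"
  by (auto simp: C_nonneg_def C_apply)

lemma continuous_map_Re: "continuous_map X euclidean f \<Longrightarrow> continuous_map X euclideanreal (\<lambda>x. Re (f x))"
  and continuous_map_Im: "continuous_map X euclidean f \<Longrightarrow> continuous_map X euclideanreal (\<lambda>x. Im (f x))"
  by (simp_all add: continuous_map_atin tendsto_Re tendsto_Im)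

lemma C_fun_extensional: "f \<in> C_fun X \<Longrightarrow> f \<in> extensional (topspace X)"
  by (simp add: C_fun_def)

lemma C_fun_continuous: "f \<in> C_fun X \<Longrightarrow> continuous_map X euclidean f"
  by (auto simp: C_fun_def)

lemma C_real_continuousD:
  assumes "C_real X r \<in> C_fun X"
  shows "continuous_map X euclideanreal r"
  using continuous_map_Re[OF C_fun_continuous[OF assms]]
  by (rule continuous_map_eq) (simp add: C_apply)

context
  fixes X :: "'a topology"
  assumes compact: "compact_space X"
begin

lemma C_restrict_mem:
  assumes "continuous_map X euclidean f"
  shows "(\<lambda>x\<in>topspace X. f x) \<in> C_fun X"
  unfolding mem_C_fun_iff[OF compact]
  using continuous_map_eq[OF assms, of "\<lambda>x\<in>topspace X. f x"] by auto

lemma C_real_mem: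
  assumes "continuous_map X euclideanreal r"
  shows "C_real X r \<in> C_fun X"
  unfolding C_real_def using assms
  by (intro C_restrict_mem) (simp add: continuous_map_atin tendsto_of_real)

lemma C_const_mem: "C_const X c \<in> C_fun X"
  unfolding C_const_def by (intro C_restrict_mem) simp

lemma C_add_mem: "f \<in> C_fun X \<Longrightarrow> g \<in> C_fun X \<Longrightarrow> C_add X f g \<in> C_fun X"
  unfolding C_add_def
  by (intro C_restrict_mem continuous_map_add) (auto dest: C_fun_continuous)

lemma C_mult_mem: "f \<in> C_fun X \<Longrightarrow> g \<in> C_fun X \<Longrightarrow> C_mult X f g \<in> C_fun X"
  unfolding C_mult_def using C_fun_continuous[of f X] C_fun_continuous[of g X]
  by (intro C_restrict_mem) (simp add: continuous_map_atin tendsto_mult)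

lemma C_scale_mem: "f \<in> C_fun X \<Longrightarrow> C_scale X c f \<in> C_fun X"
  unfolding C_scale_def using C_fun_continuous[of f X]
  by (intro C_restrict_mem) (simp add: continuous_map_atin tendsto_mult)

lemma C_star_mem: "f \<in> C_fun X \<Longrightarrow> C_star X f \<in> C_fun X"
  unfolding C_star_def using C_fun_continuous[of f X]
  by (intro C_restrict_mem) (simp add: continuous_map_atin tendsto_cnj)

lemma real_continuous_bounded:
  assumes "continuous_map X euclideanreal r"
  obtains c where "0 \<le> c" "\<And>x. x \<in> topspace X \<Longrightarrow> \<bar>r x\<bar> \<le> c"
proof -
  have "compactin euclidean (r ` topspace X)"
    using image_compactin[OF _ assms] compact unfolding compact_space_def by blast
  then have "bounded (r ` topspace X)" by (simp add: compact_imp_bounded)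
  then obtain c where "\<And>x. x \<in> topspace X \<Longrightarrow> \<bar>r x\<bar> \<le> c"
    by (auto simp: bounded_iff)
  then show thesis by (intro that[of "max 0 c"]) (auto simp: max.coboundedI2)
qed

end

section \<open>Positive functionals on function systems\<close>

definition positive_functional ::
    "'a topology \<Rightarrow> ('a \<Rightarrow> complex) set \<Rightarrow> (('a \<Rightarrow> complex) \<Rightarrow> complex) \<Rightarrow> bool" where
  "positive_functional X M T \<longleftrightarrow>
     (\<forall>a\<in>M. \<forall>b\<in>M. T (C_add X a b) = T a + T b) \<and>
     (\<forall>c. \<forall>a\<in>M. T (C_scale X c a) = c * T a) \<and>
     (\<forall>a\<in>M. C_nonneg X a \<longrightarrow> T a \<in> \<real>\<^sub>\<ge>\<^sub>0)"

lemma state_space_iff: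
  "T \<in> state_space X M \<longleftrightarrow> T \<in> extensional M \<and> positive_functional X M T \<and> T (C_const X 1) = 1"
  by (auto simp: state_space_def positive_functional_def)

lemma positive_functionalD:
  assumes "positive_functional X M T" "a \<in> M"
  shows "b \<in> M \<Longrightarrow> T (C_add X a b) = T a + T b" "T (C_scale X c a) = c * T a"
    "C_nonneg X a \<Longrightarrow> T a \<in> \<real>\<^sub>\<ge>\<^sub>0"
  using assms by (auto simp: positive_functional_def)

text \<open>The notion has to cover the linear span of a self-adjoint set of functions, which need not be norm closed,
  as well as its closure and the whole of \<open>C(X)\<close>.\<close>

locale function_system =
  fixes X :: "'a topology" and M :: "('a \<Rightarrow> complex) set"
  assumes compact: "compact_space X"
    and subset_C_fun: "M \<subseteq> C_fun X"
    and one_mem: "C_const X 1 \<in> M"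
    and add_mem: "f \<in> M \<Longrightarrow> g \<in> M \<Longrightarrow> C_add X f g \<in> M"
    and scale_mem: "f \<in> M \<Longrightarrow> C_scale X c f \<in> M"
    and star_mem: "f \<in> M \<Longrightarrow> C_star X f \<in> M"
begin

lemma const_mem: "C_const X c \<in> M"
  using scale_mem[OF one_mem] C_const_scale[of X] by metis

lemma real_const_mem: "C_real X (\<lambda>x. c) \<in> M"
  using const_mem[of "of_real c"] by (simp add: C_real_const)

lemma real_add_mem: "C_real X r \<in> M \<Longrightarrow> C_real X s \<in> M \<Longrightarrow> C_real X (\<lambda>x. r x + s x) \<in> M"
  using add_mem[of "C_real X r" "C_real X s"] by (simp add: C_real_add)

lemma real_scale_mem: "C_real X r \<in> M \<Longrightarrow> C_real X (\<lambda>x. c * r x) \<in> M"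
  using scale_mem[of "C_real X r" "of_real c"] by (simp add: C_real_scale)

lemma Re_mem:
  assumes "f \<in> M"
  shows "C_real X (\<lambda>x. Re (f x)) \<in> M"
proof -
  have "C_real X (\<lambda>x. Re (f x)) = C_scale X (1/2) (C_add X f (C_star X f))"
    by (rule C_eqI[of _ X]) (auto simp: C_apply complex_eq_iff)
  then show ?thesis using assms by (simp add: scale_mem add_mem star_mem)
qed

lemma Im_mem:
  assumes "f \<in> M"
  shows "C_real X (\<lambda>x. Im (f x)) \<in> M"
proof -
  have "C_real X (\<lambda>x. Im (f x)) = C_real X (\<lambda>x. Re (C_scale X (- \<i>) f x))"
    by (rule C_real_cong) (simp add: C_apply)
  then show ?thesis using assms by (simp add: scale_mem Re_mem)
qed

lemma real_bounded:
  assumes "C_real X r \<in> M"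
  obtains c where "0 \<le> c" "\<And>x. x \<in> topspace X \<Longrightarrow> \<bar>r x\<bar> \<le> c"
  using assms subset_C_fun real_continuous_bounded[OF compact C_real_continuousD] by blast

context
  fixes T :: "('a \<Rightarrow> complex) \<Rightarrow> complex"
  assumes T: "positive_functional X M T"
begin

lemma functional_real_add:
  "C_real X r \<in> M \<Longrightarrow> C_real X s \<in> M \<Longrightarrow>
    T (C_real X (\<lambda>x. r x + s x)) = T (C_real X r) + T (C_real X s)"
  using positive_functionalD(1)[OF T, of "C_real X r" "C_real X s"] by (simp add: C_real_add)

lemma functional_real_scale:
  "C_real X r \<in> M \<Longrightarrow> T (C_real X (\<lambda>x. c * r x)) = of_real c * T (C_real X r)"
  using positive_functionalD(2)[OF T, of "C_real X r" "of_real c"] by (simp add: C_real_scale)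

text \<open>A real function becomes nonnegative after adding a constant, and functionals are nonnegative on both.\<close>

lemma functional_real_in_Reals:
  assumes r: "C_real X r \<in> M"
  shows "T (C_real X r) \<in> \<real>"
proof -
  obtain c where c: "0 \<le> c" "\<And>x. x \<in> topspace X \<Longrightarrow> \<bar>r x\<bar> \<le> c"
    using real_bounded[OF r] by blast
  have "0 \<le> r x + c" if "x \<in> topspace X" for x
    using c(2)[OF that] by linarith
  then have "T (C_real X (\<lambda>x. r x + c)) \<in> \<real>" "T (C_real X (\<lambda>x. c)) \<in> \<real>"
    using c(1) by (auto intro!: nonneg_Reals_Real positive_functionalD(3)[OF T]
      real_add_mem real_const_mem r)
  then have "T (C_real X (\<lambda>x. r x + c)) - T (C_real X (\<lambda>x. c)) \<in> \<real>" by (rule Reals_diff)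
  then show ?thesis
    using functional_real_add[OF r real_const_mem, of c] by simp
qed

lemma functional_real_mono:
  assumes r: "C_real X r \<in> M" and s: "C_real X s \<in> M"
    and le: "\<And>x. x \<in> topspace X \<Longrightarrow> r x \<le> s x"
  shows "Re (T (C_real X r)) \<le> Re (T (C_real X s))"
proof -
  have "T (C_real X (\<lambda>x. s x + - 1 * r x)) \<in> \<real>\<^sub>\<ge>\<^sub>0"
    using le by (intro positive_functionalD(3)[OF T] real_add_mem real_scale_mem r s) auto
  then show ?thesis
    using functional_real_add[OF s real_scale_mem[OF r], of "- 1"] functional_real_scale[OF r, of "- 1"]
    by (simp add: complex_nonneg_Reals_iff)
qed

lemma functional_decompose:
  assumes f: "f \<in> M"
  shows "Re (T f) = Re (T (C_real X (\<lambda>x. Re (f x))))"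
    and "Im (T f) = Re (T (C_real X (\<lambda>x. Im (f x))))"
proof -
  have "T f = T (C_add X (C_real X (\<lambda>x. Re (f x))) (C_scale X \<i> (C_real X (\<lambda>x. Im (f x)))))"
    using f subset_C_fun by (intro arg_cong[of _ _ T] C_decompose C_fun_extensional) auto
  also have "\<dots> = T (C_real X (\<lambda>x. Re (f x))) + \<i> * T (C_real X (\<lambda>x. Im (f x)))"
    using f by (simp add: positive_functionalD[OF T] Re_mem Im_mem scale_mem)
  finally show "Re (T f) = Re (T (C_real X (\<lambda>x. Re (f x))))"
    "Im (T f) = Re (T (C_real X (\<lambda>x. Im (f x))))"
    using functional_real_in_Reals[OF Re_mem[OF f]] functional_real_in_Reals[OF Im_mem[OF f]]
    by (auto simp: complex_is_Real_iff)
qed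

lemma functional_star:
  assumes f: "f \<in> M"
  shows "T (C_star X f) = cnj (T f)"
proof -
  have "C_real X (\<lambda>x. Re (C_star X f x)) = C_real X (\<lambda>x. Re (f x))"
    "C_real X (\<lambda>x. Im (C_star X f x)) = C_real X (\<lambda>x. - 1 * Im (f x))"
    by (auto intro!: C_real_cong simp: C_apply)
  then show ?thesis
    using functional_decompose[OF f] functional_decompose[OF star_mem[OF f]]
      functional_real_scale[OF Im_mem[OF f], of "- 1"]
    by (simp add: complex_eq_iff)
qed

end

lemma state_real_const:
  assumes "t \<in> state_space X M"
  shows "t (C_real X (\<lambda>x. c)) = of_real c"
proof -
  have "C_real X (\<lambda>x. c) = C_scale X (of_real c) (C_const X 1)"
    by (rule C_eqI[of _ X]) (auto simp: C_apply)
  then show ?thesis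
    using positive_functionalD(2)[of X M t "C_const X 1" "of_real c"] assms one_mem
    by (simp add: state_space_iff)
qed

text \<open>After multiplying \<open>f\<close> by a number of modulus \<open>1\<close> the value \<open>t f\<close> is a nonnegative real, and then it is at
  most the value of \<open>t\<close> at the real part of \<open>f\<close>, which lies below the constant \<open>e\<close>.\<close>

lemma state_norm_le:
  assumes t: "t \<in> state_space X M" and f: "f \<in> M"
    and le: "\<And>x. x \<in> topspace X \<Longrightarrow> cmod (f x) \<le> e"
  shows "cmod (t f) \<le> e"
proof -
  have pos: "positive_functional X M t" using t by (simp add: state_space_iff)
  obtain c where c: "cmod c = 1" "c * t f = of_real (cmod (t f))"
  proof (cases "t f = 0")
    case True
    then show thesis by (intro that[of 1]) auto
  next
    case False
    have "cnj (t f) * t f = of_real (cmod (t f)) * of_real (cmod (t f))"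
      using complex_norm_square[of "t f"] by (simp add: power2_eq_square mult.commute)
    with False show thesis
      by (intro that[of "cnj (t f) / of_real (cmod (t f))"]) (auto simp: norm_divide)
  qed
  define g where "g = C_scale X c f"
  have g: "g \<in> M" unfolding g_def by (rule scale_mem[OF f])
  have "t g = of_real (cmod (t f))"
    using c(2) positive_functionalD(2)[OF pos f] by (simp add: g_def)
  then have "cmod (t f) = Re (t (C_real X (\<lambda>x. Re (g x))))"
    using functional_decompose(1)[OF pos g] by simp
  also have "\<dots> \<le> Re (t (C_real X (\<lambda>x. e)))"
  proof (rule functional_real_mono[OF pos Re_mem[OF g] real_const_mem])
    fix x assume x: "x \<in> topspace X"
    have "Re (g x) \<le> cmod (g x)" by (rule complex_Re_le_cmod)
    also have "\<dots> \<le> e" using le[OF x] x c(1) by (simp add: g_def C_apply norm_mult)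
    finally show "Re (g x) \<le> e" .
  qed
  finally show ?thesis using state_real_const[OF t] by simp
qed

end

section \<open>Extension of states\<close>

text \<open>The upper envelope \<open>p f = inf {t a | a \<in> M real, f \<le> a}\<close> is sublinear on the real continuous functions.
  A linear functional below \<open>p\<close> is nonnegative, since \<open>p f \<le> 0\<close> for \<open>f \<le> 0\<close>, and agrees with \<open>t\<close> on the
  real part of \<open>M\<close>, since it is below \<open>t\<close> at \<open>a\<close> and at \<open>- a\<close>.  The Hahn-Banach theorem provides one that
  attains \<open>p h\<close> at a given \<open>h\<close>; its complexification is the required state.\<close>

theorem (in function_system) state_extension:
  assumes t: "t \<in> state_space X M" and h: "continuous_map X euclideanreal h"
  obtains T where "T \<in> state_space X (C_fun X)" "\<And>a. a \<in> M \<Longrightarrow> T a = t a"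
    "Re (T (C_real X h)) =
      Inf {Re (t (C_real X a)) | a. C_real X a \<in> M \<and> (\<forall>x\<in>topspace X. h x \<le> a x)}"
proof -
  have pos: "positive_functional X M t" using t by (simp add: state_space_iff)
  define E where "E = {r. continuous_map X euclideanreal r}"
  interpret E: real_function_space E
    by unfold_locales (auto simp: E_def continuous_map_add continuous_map_real_mult_left)
  define V where "V f = {Re (t (C_real X a)) | a. C_real X a \<in> M \<and> (\<forall>x\<in>topspace X. f x \<le> a x)}" for f
  define p where "p f = Inf (V f)" for f
  have nonempty: "V f \<noteq> {}" and bdd: "bdd_below (V f)" if f: "f \<in> E" for f
  proof -
    obtain c where c: "0 \<le> c" "\<And>x. x \<in> topspace X \<Longrightarrow> \<bar>f x\<bar> \<le> c"
      using real_continuous_bounded[OF compact] f by (auto simp: E_def)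
    have bounds: "f x \<le> c \<and> - c \<le> f x" if "x \<in> topspace X" for x
      using c(2)[OF that] by linarith
    then show "V f \<noteq> {}" unfolding V_def using real_const_mem[of c] by blast
    show "bdd_below (V f)"
    proof (rule bdd_belowI[of _ "- c"])
      fix v assume "v \<in> V f"
      then obtain a where a: "C_real X a \<in> M" "\<And>x. x \<in> topspace X \<Longrightarrow> f x \<le> a x"
        "v = Re (t (C_real X a))" by (auto simp: V_def)
      have "Re (t (C_real X (\<lambda>x. - c))) \<le> Re (t (C_real X a))"
        using bounds a(2) by (intro functional_real_mono[OF pos] real_const_mem a(1)) force
      then show "- c \<le> v" using state_real_const[OF t, of "- c"] a(3) by simp
    qed
  qed
  have p_le: "p f \<le> Re (t (C_real X a))"
    if "f \<in> E" "C_real X a \<in> M" "\<And>x. x \<in> topspace X \<Longrightarrow> f x \<le> a x" for f a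
    unfolding p_def using that by (intro cInf_lower bdd) (auto simp: V_def)
  have le_p: "c \<le> p f"
    if "f \<in> E" "\<And>a. C_real X a \<in> M \<Longrightarrow> (\<And>x. x \<in> topspace X \<Longrightarrow> f x \<le> a x) \<Longrightarrow>
      c \<le> Re (t (C_real X a))" for c f
    unfolding p_def using that by (intro cInf_greatest nonempty) (auto simp: V_def)
  have "E.sublinear p"
  proof (rule E.sublinearI)
    have "p (\<lambda>x. 0) \<le> 0"
      using p_le[OF E.zero_mem real_const_mem[of 0]] state_real_const[OF t, of 0] by simp
    moreover have "0 \<le> p (\<lambda>x. 0)"
      using functional_real_mono[OF pos real_const_mem[of 0]] state_real_const[OF t, of 0]
      by (intro le_p E.zero_mem) simp
    ultimately show "p (\<lambda>x. 0) = 0" by simp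
  next
    fix f :: "'a \<Rightarrow> real" and c :: real
    assume f: "f \<in> E" and c: "0 < c"
    have "p (\<lambda>x. c * f x) / c \<le> Re (t (C_real X a))"
      if a: "C_real X a \<in> M" "\<And>x. x \<in> topspace X \<Longrightarrow> f x \<le> a x" for a
      using p_le[OF E.scale_mem[OF f]
          real_scale_mem[OF a(1)], of c c] a(2) c functional_real_scale[OF pos a(1), of c]
      by (simp add: field_simps)
    then have "p (\<lambda>x. c * f x) / c \<le> p f" using f by (intro le_p) auto
    then show "p (\<lambda>x. c * f x) \<le> c * p f" using c by (simp add: field_simps)
  next
    fix f g assume f: "f \<in> E" and g: "g \<in> E"
    have fg: "(\<lambda>x. f x + g x) \<in> E" using f g by (rule E.add_mem)
    have "p (\<lambda>x. f x + g x) - Re (t (C_real X a)) \<le> p g"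
      if a: "C_real X a \<in> M" "\<And>x. x \<in> topspace X \<Longrightarrow> f x \<le> a x" for a
    proof (rule le_p[OF g])
      fix b assume b: "C_real X b \<in> M" "\<And>x. x \<in> topspace X \<Longrightarrow> g x \<le> b x"
      have "p (\<lambda>x. f x + g x) \<le> Re (t (C_real X (\<lambda>x. a x + b x)))"
        using a(2) b(2) by (intro p_le[OF fg real_add_mem[OF a(1) b(1)]] add_mono)
      then show "p (\<lambda>x. f x + g x) - Re (t (C_real X a)) \<le> Re (t (C_real X b))"
        using functional_real_add[OF pos a(1) b(1)] by simp
    qed
    then have "p (\<lambda>x. f x + g x) - p g \<le> p f"
      using f by (intro le_p) (auto simp: algebra_simps)
    then show "p (\<lambda>x. f x + g x) \<le> p f + p g" by simp
  qed
  moreover have hE: "h \<in> E" using h by (simp add: E_def)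
  ultimately obtain F where F: "E.linear_functional F" "\<And>f. f \<in> E \<Longrightarrow> F f \<le> p f" "F h = p h"
    using E.hahn_banach by blast
  have F_add: "F (\<lambda>x. f x + g x) = F f + F g" if "f \<in> E" "g \<in> E" for f g
    using F(1) that by (simp add: E.linear_functional_def)
  have F_scale: "F (\<lambda>x. c * f x) = c * F f" if "f \<in> E" for f c
    using F(1) that by (simp add: E.linear_functional_def)
  have F_le: "F f \<le> Re (t (C_real X a))"
    if "f \<in> E" "C_real X a \<in> M" "\<And>x. x \<in> topspace X \<Longrightarrow> f x \<le> a x" for f a
    using F(2)[OF that(1)] p_le[OF that] by simp
  have F_eq: "F a = Re (t (C_real X a))" if a: "C_real X a \<in> M" for a
  proof -
    have aE: "a \<in> E" using a subset_C_fun C_real_continuousD by (auto simp: E_def)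
    have "F (\<lambda>x. - 1 * a x) \<le> Re (t (C_real X (\<lambda>x. - 1 * a x)))"
      by (intro F_le E.scale_mem aE real_scale_mem a) simp
    then show ?thesis
      using F_le[OF aE a] F_scale[OF aE, of "- 1"] functional_real_scale[OF pos a, of "- 1"] by simp
  qed
  have F_mono: "F f \<le> F g" if f: "f \<in> E" and g: "g \<in> E"
    and le: "\<And>x. x \<in> topspace X \<Longrightarrow> f x \<le> g x" for f g
  proof -
    have "(\<lambda>x. f x + - 1 * g x) \<in> E"
      using f E.scale_mem[OF g, of "- 1"] by (rule E.add_mem)
    then have "F (\<lambda>x. f x + - 1 * g x) \<le> Re (t (C_real X (\<lambda>x. 0)))"
      using le by (intro F_le real_const_mem) auto
    then show ?thesis
      using F_add[OF f E.scale_mem[OF g], of "- 1"] F_scale[OF g, of "- 1"] state_real_const[OF t, of 0] by simp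
  qed
  have F_cong: "F f = F g" if "f \<in> E" "g \<in> E" "\<And>x. x \<in> topspace X \<Longrightarrow> f x = g x" for f g
    using F_mono[of f g] F_mono[of g f] that by (simp add: order_antisym)
  have ReE: "(\<lambda>x. Re (f x)) \<in> E" and ImE: "(\<lambda>x. Im (f x)) \<in> E" if "f \<in> C_fun X" for f
    using C_fun_continuous[OF that] by (auto simp: E_def continuous_map_Re continuous_map_Im)
  define T where "T = (\<lambda>f\<in>C_fun X. Complex (F (\<lambda>x. Re (f x))) (F (\<lambda>x. Im (f x))))"
  have T_ext: "T a = t a" if a: "a \<in> M" for a
    using a subset_C_fun functional_decompose[OF pos a] F_eq[OF Re_mem[OF a]] F_eq[OF Im_mem[OF a]]
    by (auto simp: T_def complex_eq_iff)
  have "positive_functional X (C_fun X) T"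
    unfolding positive_functional_def
  proof (intro conjI ballI allI impI)
    fix f g assume f: "f \<in> C_fun X" and g: "g \<in> C_fun X"
    have fg: "C_add X f g \<in> C_fun X" by (rule C_add_mem[OF compact f g])
    have "F (\<lambda>x. Re (C_add X f g x)) = F (\<lambda>x. Re (f x) + Re (g x))"
      "F (\<lambda>x. Im (C_add X f g x)) = F (\<lambda>x. Im (f x) + Im (g x))"
      by (auto intro!: F_cong ReE ImE E.add_mem f g fg simp: C_apply)
    then show "T (C_add X f g) = T f + T g"
      using f g fg by (simp add: T_def F_add ReE ImE complex_eq_iff)
  next
    fix c f assume f: "f \<in> C_fun X"
    have cf: "C_scale X c f \<in> C_fun X" by (rule C_scale_mem[OF compact f])
    have E: "(\<lambda>x. Re c * Re (f x) + - Im c * Im (f x)) \<in> E"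
      "(\<lambda>x. Re c * Im (f x) + Im c * Re (f x)) \<in> E"
      by (intro E.add_mem E.scale_mem ReE ImE f)+
    have "F (\<lambda>x. Re (C_scale X c f x)) = F (\<lambda>x. Re c * Re (f x) + - Im c * Im (f x))"
      by (rule F_cong[OF ReE[OF cf] E(1)]) (simp add: C_apply)
    also have "\<dots> = Re c * F (\<lambda>x. Re (f x)) + - Im c * F (\<lambda>x. Im (f x))"
      by (simp only: F_add F_scale E.scale_mem ReE ImE f)
    finally have "F (\<lambda>x. Re (C_scale X c f x)) =
      Re c * F (\<lambda>x. Re (f x)) + - Im c * F (\<lambda>x. Im (f x))" .
    moreover have "F (\<lambda>x. Im (C_scale X c f x)) = F (\<lambda>x. Re c * Im (f x) + Im c * Re (f x))"
      by (rule F_cong[OF ImE[OF cf] E(2)]) (simp add: C_apply)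
    ultimately show "T (C_scale X c f) = c * T f"
      using f cf by (simp add: T_def F_add F_scale E.scale_mem ReE ImE complex_eq_iff del: mult_minus_left)
  next
    fix f assume f: "f \<in> C_fun X" and nn: "C_nonneg X f"
    have "F (\<lambda>x. 0) \<le> F (\<lambda>x. Re (f x))"
      using nn by (intro F_mono E.zero_mem ReE f) (auto simp: C_nonneg_def complex_nonneg_Reals_iff)
    moreover have "F (\<lambda>x. Im (f x)) = F (\<lambda>x. 0)"
      using nn by (intro F_cong E.zero_mem ImE f) (auto simp: C_nonneg_def complex_nonneg_Reals_iff)
    moreover have "F (\<lambda>x. 0) = 0" using F_scale[OF E.zero_mem, of 0] by simp
    ultimately show "T f \<in> \<real>\<^sub>\<ge>\<^sub>0" using f by (simp add: T_def complex_nonneg_Reals_iff)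
  qed
  moreover have "T \<in> extensional (C_fun X)" by (simp add: T_def)
  moreover have "T (C_const X 1) = 1" using T_ext[OF one_mem] t by (simp add: state_space_iff)
  ultimately have "T \<in> state_space X (C_fun X)" by (simp add: state_space_iff)
  moreover have "Re (T (C_real X h)) = Inf (V h)"
  proof -
    have hC: "C_real X h \<in> C_fun X" by (rule C_real_mem[OF compact h])
    then have "Re (T (C_real X h)) = F h"
      using F_cong[OF ReE[OF hC] hE] by (simp add: T_def C_apply)
    then show ?thesis using F(3) by (simp add: p_def)
  qed
  ultimately show thesis using T_ext by (intro that[of T]) (auto simp: V_def)
qed

section \<open>Uniform approximation and linear spans\<close>

lemma function_system_C_fun: "compact_space X \<Longrightarrow> function_system X (C_fun X)"
  by unfold_locales
    (simp_all add: C_const_mem C_add_mem C_scale_mem C_star_mem)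

lemma C_dist_le:
  assumes "\<And>x. x \<in> topspace X \<Longrightarrow> cmod (f x - g x) \<le> B" "0 \<le> B"
    and "f \<in> C_fun X" "g \<in> C_fun X"
  shows "mdist (C_metric X) f g \<le> B"
  using assms by (intro mdist_cfunspace_le) (auto simp: dist_norm)

lemma C_apply_dist_le:
  assumes "f \<in> C_fun X" "g \<in> C_fun X" "x \<in> topspace X"
  shows "cmod (f x - g x) \<le> mdist (C_metric X) f g"
  using mdist_cfunspace_imp_mdist_le[of f X euclidean_metric g "mdist (C_metric X) f g" x] assms
  by (simp add: C_fun_def dist_norm)

lemma closure_of_C_metric:
  assumes "S \<subseteq> C_fun X"
  shows "mtopology_of (C_metric X) closure_of S =
    {a \<in> C_fun X. \<forall>e>0. \<exists>g\<in>S. \<forall>x\<in>topspace X. cmod (a x - g x) \<le> e}"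
proof -
  interpret Metric_space "C_fun X" "mdist (C_metric X)"
    unfolding C_fun_def by (rule Metric_space_mspace_mdist)
  have "(\<exists>g\<in>S. g \<in> mcball a e) \<longleftrightarrow> (\<exists>g\<in>S. \<forall>x\<in>topspace X. cmod (a x - g x) \<le> e)"
    if "a \<in> C_fun X" "0 < e" for a e
  proof -
    have "g \<in> mcball a e \<longleftrightarrow> (\<forall>x\<in>topspace X. cmod (a x - g x) \<le> e)" if g: "g \<in> S" for g
    proof -
      have gC: "g \<in> C_fun X" using g assms by blast
      have "mdist (C_metric X) a g \<le> e \<longleftrightarrow> (\<forall>x\<in>topspace X. cmod (a x - g x) \<le> e)"
        using C_apply_dist_le[OF \<open>a \<in> C_fun X\<close> gC] \<open>0 < e\<close>
        by (auto intro!: C_dist_le \<open>a \<in> C_fun X\<close> gC intro: order_trans)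
      then show ?thesis
        using \<open>a \<in> C_fun X\<close> gC unfolding in_mcball by simp
    qed
    then show ?thesis by blast
  qed
  then show ?thesis
    unfolding mtopology_of_def C_fun_def[symmetric] metric_closure_of_alt by blast
qed

lemma lin_span_superset:
  assumes "S \<subseteq> C_fun X"
  shows "S \<subseteq> lin_span X S"
proof
  fix g assume g: "g \<in> S"
  have "g = (\<lambda>x\<in>topspace X. \<Sum>h\<in>{g}. 1 * h x)"
    using g assms C_fun_extensional by (intro C_eqI[of _ X]) auto
  then show "g \<in> lin_span X S"
    unfolding lin_span_def using g by (intro CollectI exI[of _ "{g}"] exI[of _ "\<lambda>_. 1"]) auto
qed

lemma lin_span_zero: "C_const X 0 \<in> lin_span X S"
  unfolding lin_span_def C_const_def by (intro CollectI exI[of _ "{}"]) auto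

lemma lin_span_scale:
  assumes "f \<in> lin_span X S"
  shows "C_scale X c f \<in> lin_span X S"
proof -
  obtain T d where T: "finite T" "T \<subseteq> S" "f = (\<lambda>x\<in>topspace X. \<Sum>g\<in>T. d g * g x)"
    using assms by (auto simp: lin_span_def)
  have "C_scale X c f = (\<lambda>x\<in>topspace X. \<Sum>g\<in>T. (c * d g) * g x)"
    by (rule C_eqI[of _ X]) (auto simp: C_apply T(3) sum_distrib_left mult.assoc)
  then show ?thesis
    unfolding lin_span_def using T by (intro CollectI exI[of _ T] exI[of _ "\<lambda>g. c * d g"]) auto
qed

lemma lin_span_add:
  assumes "f \<in> lin_span X S" "f' \<in> lin_span X S"
  shows "C_add X f f' \<in> lin_span X S"
proof -
  obtain T d where T: "finite T" "T \<subseteq> S" "f = (\<lambda>x\<in>topspace X. \<Sum>g\<in>T. d g * g x)"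
    using assms by (auto simp: lin_span_def)
  obtain T' d' where T': "finite T'" "T' \<subseteq> S" "f' = (\<lambda>x\<in>topspace X. \<Sum>g\<in>T'. d' g * g x)"
    using assms by (auto simp: lin_span_def)
  define e where "e g = (if g \<in> T then d g else 0) + (if g \<in> T' then d' g else 0)" for g
  have "(\<Sum>g\<in>T. d g * g x) = (\<Sum>g\<in>T \<union> T'. (if g \<in> T then d g else 0) * g x)"
    "(\<Sum>g\<in>T'. d' g * g x) = (\<Sum>g\<in>T \<union> T'. (if g \<in> T' then d' g else 0) * g x)" for x
    using T(1) T'(1) by (auto intro!: sum.mono_neutral_cong_left)
  then have "(\<Sum>g\<in>T. d g * g x) + (\<Sum>g\<in>T'. d' g * g x) = (\<Sum>g\<in>T \<union> T'. e g * g x)" for x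
    by (simp add: e_def distrib_right sum.distrib)
  then have "C_add X f f' = (\<lambda>x\<in>topspace X. \<Sum>g\<in>T \<union> T'. e g * g x)"
    by (intro C_eqI[of _ X]) (auto simp: C_apply T(3) T'(3))
  then show ?thesis
    unfolding lin_span_def using T T' by (intro CollectI exI[of _ "T \<union> T'"] exI[of _ e]) auto
qed

text \<open>An induction principle for spans: it reduces closure properties of a span to its generators.\<close>

lemma lin_span_subset:
  assumes zero: "C_const X 0 \<in> B"
    and scale: "\<And>g c. g \<in> S \<Longrightarrow> C_scale X c g \<in> B"
    and add: "\<And>f g. f \<in> B \<Longrightarrow> g \<in> B \<Longrightarrow> C_add X f g \<in> B"
  shows "lin_span X S \<subseteq> B"
proof
  fix f assume "f \<in> lin_span X S"
  then obtain T d where T: "finite T" "T \<subseteq> S" and f: "f = (\<lambda>x\<in>topspace X. \<Sum>g\<in>T. d g * g x)"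
    by (auto simp: lin_span_def)
  define F where "F U = (\<lambda>x\<in>topspace X. \<Sum>g\<in>U. d g * g x)" for U
  from T have "F T \<in> B"
  proof (induction T rule: finite_induct)
    case empty
    have "F {} = C_const X 0" by (simp add: F_def C_const_def)
    then show ?case using zero by simp
  next
    case (insert h T)
    have "F (insert h T) = C_add X (C_scale X (d h) h) (F T)"
      using insert.hyps by (intro C_eqI[of _ X]) (auto simp: F_def C_apply)
    then show ?case using insert by (simp add: add scale)
  qed
  then show "f \<in> B" by (simp add: f F_def)
qed

lemma function_system_lin_span:
  assumes X: "compact_space X" and G: "G \<subseteq> C_fun X" and one: "C_const X 1 \<in> G"
  shows "function_system X (lin_span X (G \<union> C_star X ` G))"
proof -
  let ?S = "G \<union> C_star X ` G"
  have S: "?S \<subseteq> C_fun X" using G C_star_mem[OF X] by auto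
  have star_S: "C_star X g \<in> ?S" if "g \<in> ?S" for g
  proof -
    have "C_star X (C_star X h) = h" if "h \<in> G" for h
      using that G C_fun_extensional by (intro C_eqI[of _ X]) (auto simp: C_apply)
    then show ?thesis using \<open>g \<in> ?S\<close> by auto
  qed
  have sub: "lin_span X ?S \<subseteq> C_fun X"
    using S by (intro lin_span_subset) (auto intro: C_const_mem[OF X] C_scale_mem[OF X] C_add_mem[OF X])
  have star_eq: "C_star X (C_const X 0) = C_const X 0"
      "C_star X (C_scale X c f) = C_scale X (cnj c) (C_star X f)"
      "C_star X (C_add X f g) = C_add X (C_star X f) (C_star X g)" for c f g
    by (rule C_eqI[of _ X]; simp add: C_apply)+
  have star: "lin_span X ?S \<subseteq> {f. C_star X f \<in> lin_span X ?S}"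
  proof (rule lin_span_subset)
    fix g c assume "g \<in> ?S"
    then have "C_star X g \<in> lin_span X ?S" using star_S lin_span_superset[OF S] by blast
    then show "C_scale X c g \<in> {f. C_star X f \<in> lin_span X ?S}"
      by (simp add: star_eq lin_span_scale)
  qed (simp_all add: star_eq lin_span_zero lin_span_add)
  show ?thesis
    using X sub star one lin_span_superset[OF S]
    by unfold_locales (auto intro: lin_span_add lin_span_scale)
qed

context function_system
begin

lemma function_system_closure: "function_system X (mtopology_of (C_metric X) closure_of M)"
  unfolding closure_of_C_metric[OF subset_C_fun]
proof unfold_locales
  let ?A = "{a \<in> C_fun X. \<forall>e>0. \<exists>g\<in>M. \<forall>x\<in>topspace X. cmod (a x - g x) \<le> e}"
  show "compact_space X" by (rule compact)
  show "?A \<subseteq> C_fun X" by blast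
  show "C_const X 1 \<in> ?A"
    using one_mem C_const_mem[OF compact] by (auto intro!: bexI[of _ "C_const X 1"])
  fix f assume f: "f \<in> ?A"
  show "C_add X f f' \<in> ?A" if f': "f' \<in> ?A" for f'
  proof -
    have "\<exists>g\<in>M. \<forall>x\<in>topspace X. cmod (C_add X f f' x - g x) \<le> e" if "0 < e" for e
    proof -
      from \<open>0 < e\<close> have "0 < e / 2" by simp
      then obtain g where g: "g \<in> M" "\<And>x. x \<in> topspace X \<Longrightarrow> cmod (f x - g x) \<le> e / 2"
        using f by blast
      from \<open>0 < e / 2\<close> obtain g' where g': "g' \<in> M" "\<And>x. x \<in> topspace X \<Longrightarrow> cmod (f' x - g' x) \<le> e / 2"
        using f' by blast
      have "cmod (C_add X f f' x - C_add X g g' x) \<le> e" if x: "x \<in> topspace X" for x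
      proof -
        have "cmod (f x - g x + (f' x - g' x)) \<le> e / 2 + e / 2"
          by (intro norm_triangle_mono g(2) g'(2) x)
        then show ?thesis using x by (simp add: C_apply algebra_simps)
      qed
      then show ?thesis using add_mem[OF g(1) g'(1)] by blast
    qed
    then show ?thesis using f f' C_add_mem[OF compact] by blast
  qed
  show "C_star X f \<in> ?A"
  proof -
    have "\<exists>g\<in>M. \<forall>x\<in>topspace X. cmod (C_star X f x - g x) \<le> e" if "0 < e" for e
    proof -
      obtain g where g: "g \<in> M" "\<And>x. x \<in> topspace X \<Longrightarrow> cmod (f x - g x) \<le> e"
        using f \<open>0 < e\<close> by blast
      have "cmod (C_star X f x - C_star X g x) \<le> e" if x: "x \<in> topspace X" for x
        using g(2)[OF x] x complex_mod_cnj[of "f x - g x"] by (simp add: C_apply)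
      then show ?thesis using star_mem[OF g(1)] by blast
    qed
    then show ?thesis using f C_star_mem[OF compact] by blast
  qed
  show "C_scale X c f \<in> ?A" for c
  proof -
    have "\<exists>g\<in>M. \<forall>x\<in>topspace X. cmod (C_scale X c f x - g x) \<le> e" if "0 < e" for e
    proof -
      have "0 < e / (cmod c + 1)" using \<open>0 < e\<close> by (simp add: add_nonneg_pos)
      then obtain g where g: "g \<in> M" "\<And>x. x \<in> topspace X \<Longrightarrow> cmod (f x - g x) \<le> e / (cmod c + 1)"
        using f by blast
      have "cmod (C_scale X c f x - C_scale X c g x) \<le> e" if x: "x \<in> topspace X" for x
      proof -
        have "cmod (C_scale X c f x - C_scale X c g x) = cmod c * cmod (f x - g x)"
          using x by (simp add: C_apply norm_mult[symmetric] right_diff_distrib)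
        also have "\<dots> \<le> (cmod c + 1) * (e / (cmod c + 1))"
          by (intro mult_mono g(2) x) auto
        also have "\<dots> = e" by (simp add: add_nonneg_eq_0_iff)
        finally show ?thesis .
      qed
      then show ?thesis using scale_mem[OF g(1)] by blast
    qed
    then show ?thesis using f C_scale_mem[OF compact] by blast
  qed
qed

lemma state_diff_le:
  assumes t: "t \<in> state_space X M" and f: "f \<in> M" and g: "g \<in> M"
    and le: "\<And>x. x \<in> topspace X \<Longrightarrow> cmod (f x - g x) \<le> e"
  shows "cmod (t f - t g) \<le> e"
proof -
  have pos: "positive_functional X M t" using t by (simp add: state_space_iff)
  have "cmod (t (C_add X f (C_scale X (- 1) g))) \<le> e"
    using le by (intro state_norm_le[OF t] add_mem scale_mem f g) (simp add: C_apply)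
  then show ?thesis
    using f g by (simp add: positive_functionalD[OF pos] scale_mem)
qed

end

section \<open>The Choquet boundary and uniqueness of extensions\<close>

text \<open>In measure-theoretic terms: \<open>\<delta>\<^sub>x\<close> is the only regular Borel probability measure on \<open>X\<close> that represents evaluation at
  \<open>x\<close> on \<open>M\<close>.\<close>

definition unique_extension :: "'a topology \<Rightarrow> ('a \<Rightarrow> complex) set \<Rightarrow> 'a \<Rightarrow> bool" where
  "unique_extension X M x \<longleftrightarrow>
     (\<forall>T\<in>state_space X (C_fun X). (\<forall>a\<in>M. T a = a x) \<longrightarrow> (\<forall>f\<in>C_fun X. T f = f x))"

lemma eq_if_norm_le_all:
  fixes z w :: "'a::real_normed_vector"
  assumes "\<And>e. 0 < e \<Longrightarrow> norm (z - w) \<le> e"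
  shows "z = w"
proof -
  have "norm (z - w) \<le> 0 + e" if "0 < e" for e using assms[OF that] by simp
  then have "norm (z - w) \<le> 0" by (rule field_le_epsilon)
  then show ?thesis by simp
qed

text \<open>A state of \<open>C(X)\<close> is norm continuous, so agreement with evaluation at \<open>x\<close> passes from \<open>M\<close> to its closure.\<close>

lemma (in function_system) unique_extension_of_closure:
  assumes "unique_extension X (mtopology_of (C_metric X) closure_of M) x" and x: "x \<in> topspace X"
  shows "unique_extension X M x"
  unfolding unique_extension_def
proof (intro ballI impI)
  interpret C: function_system X "C_fun X" by (rule function_system_C_fun[OF compact])
  fix T f assume T: "T \<in> state_space X (C_fun X)" and M: "\<forall>a\<in>M. T a = a x" and f: "f \<in> C_fun X"
  have "T a = a x" if "a \<in> mtopology_of (C_metric X) closure_of M" for a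
  proof -
    have aC: "a \<in> C_fun X"
      and approx: "\<And>e. 0 < e \<Longrightarrow> \<exists>g\<in>M. \<forall>x\<in>topspace X. cmod (a x - g x) \<le> e"
      using that by (auto simp: closure_of_C_metric[OF subset_C_fun])
    have "cmod (T a - a x) \<le> e" if "0 < e" for e
    proof -
      from that have "0 < e / 2" by simp
      then obtain g where g: "g \<in> M" "\<And>x. x \<in> topspace X \<Longrightarrow> cmod (a x - g x) \<le> e / 2"
        using approx by blast
      have "cmod (T a - T g) \<le> e / 2"
        using g subset_C_fun by (intro C.state_diff_le[OF T aC]) auto
      moreover have "cmod (g x - a x) \<le> e / 2"
        using g(2)[OF x] by (simp add: norm_minus_commute)
      ultimately have "cmod (T a - T g + (g x - a x)) \<le> e / 2 + e / 2"
        by (rule norm_triangle_mono)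
      then show ?thesis using M g(1) by simp
    qed
    then show ?thesis by (rule eq_if_norm_le_all)
  qed
  then show "T f = f x" using assms(1) T f by (auto simp: unique_extension_def)
qed

context function_system
begin

lemma positive_functional_multiply:
  assumes T: "positive_functional X (C_fun X) T"
    and h: "continuous_map X euclideanreal h" "\<And>x. x \<in> topspace X \<Longrightarrow> 0 \<le> h x"
  shows "positive_functional X (C_fun X) (\<lambda>f. T (C_mult X (C_real X h) f))"
  unfolding positive_functional_def
proof (intro conjI ballI allI impI)
  note hC = C_real_mem[OF compact h(1)] and mem = C_mult_mem[OF compact]
  fix f assume f: "f \<in> C_fun X"
  show "T (C_mult X (C_real X h) (C_add X f g)) =
      T (C_mult X (C_real X h) f) + T (C_mult X (C_real X h) g)" if g: "g \<in> C_fun X" for g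
  proof -
    have "C_mult X (C_real X h) (C_add X f g) =
        C_add X (C_mult X (C_real X h) f) (C_mult X (C_real X h) g)"
      by (rule C_eqI[of _ X]) (auto simp: C_apply algebra_simps)
    then show ?thesis using mem[OF hC f] mem[OF hC g] by (simp add: positive_functionalD[OF T])
  qed
  show "T (C_mult X (C_real X h) (C_scale X c f)) = c * T (C_mult X (C_real X h) f)" for c
  proof -
    have "C_mult X (C_real X h) (C_scale X c f) = C_scale X c (C_mult X (C_real X h) f)"
      by (rule C_eqI[of _ X]) (auto simp: C_apply)
    then show ?thesis using mem[OF hC f] by (simp add: positive_functionalD[OF T])
  qed
  show "T (C_mult X (C_real X h) f) \<in> \<real>\<^sub>\<ge>\<^sub>0" if "C_nonneg X f"
    using that h(2) mem[OF hC f]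
    by (intro positive_functionalD(3)[OF T]) (auto simp: C_nonneg_def C_apply)
qed

text \<open>Normalising and restricting to \<open>M\<close>: this produces the two states into which a point state decomposes.\<close>

lemma restricted_state:
  assumes T: "positive_functional X (C_fun X) T" and r: "T (C_const X 1) = of_real r" "0 < r"
  shows "(\<lambda>a\<in>M. T a / of_real r) \<in> state_space X M"
proof -
  have "T a / of_real r \<in> \<real>\<^sub>\<ge>\<^sub>0" if "a \<in> M" "C_nonneg X a" for a
    using positive_functionalD(3)[OF T] that subset_C_fun r(2)
    by (intro nonneg_Reals_divide_I) auto
  then have "positive_functional X M (\<lambda>a\<in>M. T a / of_real r)"
    using subset_C_fun positive_functionalD[OF T]
    by (auto simp: positive_functional_def add_mem scale_mem add_divide_distrib subset_iff)
  then show ?thesis using r one_mem by (simp add: state_space_iff)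
qed

text \<open>Shift and rescale \<open>h\<close> to functions \<open>k\<close> and \<open>1 - k\<close>, both with values in \<open>[1/4, 3/4]\<close>.  Then
  \<open>T = T (k \<cdot>) + T ((1 - k) \<cdot>)\<close> writes evaluation at \<open>x\<close> on \<open>M\<close> as a proper convex combination of two states,
  and extremality identifies both of them with it: \<open>T (k a) = T k a(x)\<close>.  Undoing the affine change of \<open>h\<close>
  gives the claim.\<close>

lemma choquet_boundary_multiplicative_real:
  assumes x: "x \<in> choquet_boundary X M"
    and T: "T \<in> state_space X (C_fun X)" and eval: "\<And>a. a \<in> M \<Longrightarrow> T a = a x"
    and h: "continuous_map X euclideanreal h" and a: "a \<in> M"
  shows "T (C_mult X (C_real X h) a) = T (C_real X h) * a x"
proof -
  interpret C: function_system X "C_fun X" by (rule function_system_C_fun[OF compact])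
  have pos: "positive_functional X (C_fun X) T" and T1: "T (C_const X 1) = 1"
    using T by (auto simp: state_space_iff)
  have aC: "a \<in> C_fun X" using a subset_C_fun by blast
  obtain c where c: "0 \<le> c" "\<And>x. x \<in> topspace X \<Longrightarrow> \<bar>h x\<bar> \<le> c"
    using real_continuous_bounded[OF compact h] by blast
  \<comment> \<open>The summand \<open>1\<close> keeps the denominator positive when \<open>h\<close> vanishes.\<close>
  define d where "d = 1 / (4 * (c + 1))"
  have d: "0 < d" using c(1) by (simp add: d_def)
  have dh: "\<bar>d * h y\<bar> \<le> 1 / 4" if "y \<in> topspace X" for y
  proof -
    have "\<bar>d * h y\<bar> \<le> d * (c + 1)" using c(2)[OF that] d by (simp add: abs_mult)
    also have "\<dots> = 1 / 4" using c(1) by (simp add: d_def field_simps)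
    finally show ?thesis .
  qed
  \<comment> \<open>\<open>k 1\<close> is the weight \<open>k\<close>, and \<open>k (- 1)\<close> is \<open>1 - k\<close>.\<close>
  define k where "k s y = 1 / 2 + s * (d * h y)" for s :: real and y
  have k_cont: "continuous_map X euclideanreal (k s)" for s
    unfolding k_def[abs_def] using h
    by (intro continuous_map_add continuous_map_real_mult_left) auto
  have k_bounds: "1 / 4 \<le> k 1 y \<and> k 1 y \<le> 3 / 4 \<and> 1 / 4 \<le> k (- 1) y \<and> k (- 1) y \<le> 3 / 4"
    if "y \<in> topspace X" for y
    using dh[OF that] by (auto simp: k_def abs_le_iff)
  define S where "S s f = T (C_mult X (C_real X (k s)) f)" for s f
  have S: "positive_functional X (C_fun X) (S s)" if "s = 1 \<or> s = - 1" for s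
    unfolding S_def[abs_def] using that k_bounds
    by (intro positive_functional_multiply pos k_cont) force
  have S_one: "S s (C_const X 1) = T (C_real X (k s))" for s
    unfolding S_def by (rule arg_cong[of _ _ T], rule C_eqI[of _ X]) (auto simp: C_apply)
  define r where "r = Re (T (C_real X (k 1)))"
  have r: "T (C_real X (k 1)) = of_real r"
    using C.functional_real_in_Reals[OF pos C_real_mem[OF compact k_cont], of 1]
    by (simp add: r_def of_real_Re)
  have S_sum: "S 1 f + S (- 1) f = T f" if f: "f \<in> C_fun X" for f
  proof -
    have "T f = T (C_add X (C_mult X (C_real X (k 1)) f) (C_mult X (C_real X (k (- 1))) f))"
      using C_fun_extensional[OF f]
      by (intro arg_cong[of _ _ T] C_eqI[of _ X]) (auto simp: C_apply k_def algebra_simps)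
    also have "\<dots> = S 1 f + S (- 1) f"
      unfolding S_def
      by (intro positive_functionalD(1)[OF pos] C_mult_mem C_real_mem compact k_cont f)
    finally show ?thesis by simp
  qed
  have "Re (T (C_real X (\<lambda>y. 1 / 4))) \<le> r"
    unfolding r_def using k_bounds
    by (intro C.functional_real_mono[OF pos] C_real_mem compact k_cont) auto
  moreover have "r \<le> Re (T (C_real X (\<lambda>y. 3 / 4)))"
    unfolding r_def using k_bounds
    by (intro C.functional_real_mono[OF pos] C_real_mem compact k_cont) auto
  ultimately have r01: "0 < r" "r < 1"
    using C.state_real_const[OF T, of "1 / 4"] C.state_real_const[OF T, of "3 / 4"] by auto
  have S1: "S 1 (C_const X 1) = of_real r" using S_one r by simp
  have S2: "S (- 1) (C_const X 1) = of_real (1 - r)"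
    using S_sum[OF C.one_mem] S1 T1 by (simp add: algebra_simps)
  define t u where "t = (\<lambda>a\<in>M. S 1 a / of_real r)" and "u = (\<lambda>a\<in>M. S (- 1) a / of_real (1 - r))"
  have "t \<in> state_space X M" "u \<in> state_space X M"
    unfolding t_def u_def
    by (intro restricted_state[OF S S1] restricted_state[OF S S2]; use r01 in simp)+
  moreover have "point_state M x = (\<lambda>a\<in>M. of_real r * t a + of_real (1 - r) * u a)"
  proof -
    have "b x = of_real r * t b + of_real (1 - r) * u b" if b: "b \<in> M" for b
    proof -
      have "of_real r * t b + of_real (1 - r) * u b = S 1 b + S (- 1) b"
        using r01 b of_real_eq_iff[of "1 - r" 0, where 'a = complex] by (simp add: t_def u_def)
      then show ?thesis using S_sum[of b] eval[OF b] b subset_C_fun by auto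
    qed
    then show ?thesis by (auto simp: point_state_def)
  qed
  ultimately have "t = point_state M x"
    using x r01 by (auto simp: choquet_boundary_def extreme_state_def)
  then have "S 1 a / of_real r = a x"
    using a by (auto simp: t_def point_state_def dest!: fun_cong[of _ _ a])
  then have S_a: "S 1 a = T (C_real X (k 1)) * a x" using r01 r by (simp add: field_simps)
  have hC: "C_real X h \<in> C_fun X" by (rule C_real_mem[OF compact h])
  have "C_mult X (C_real X (k 1)) a =
      C_add X (C_scale X (1 / 2) a) (C_scale X (of_real d) (C_mult X (C_real X h) a))"
    by (rule C_eqI[of _ X]) (auto simp: C_apply k_def algebra_simps)
  then have "S 1 a = 1 / 2 * a x + of_real d * T (C_mult X (C_real X h) a)"
    using eval[OF a] aC hC
    by (simp add: S_def positive_functionalD[OF pos] C_scale_mem[OF compact] C_mult_mem[OF compact])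
  moreover have "C_real X (k 1) =
      C_add X (C_const X (1 / 2)) (C_scale X (of_real d) (C_real X h))"
    by (rule C_eqI[of _ X]) (auto simp: C_apply k_def)
  then have "T (C_real X (k 1)) = 1 / 2 + of_real d * T (C_real X h)"
    using hC C.const_mem T1 positive_functionalD(2)[OF pos C.one_mem, of "1 / 2"]
    by (simp add: positive_functionalD[OF pos] C_scale_mem[OF compact] C_const_scale[of X "1/2"])
  ultimately have "of_real d * T (C_mult X (C_real X h) a) = of_real d * (T (C_real X h) * a x)"
    using S_a by (auto simp: algebra_simps)
  then show ?thesis using d by simp
qed

lemma choquet_boundary_multiplicative:
  assumes x: "x \<in> choquet_boundary X M"
    and T: "T \<in> state_space X (C_fun X)" and eval: "\<And>a. a \<in> M \<Longrightarrow> T a = a x"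
    and h: "h \<in> C_fun X" and a: "a \<in> M"
  shows "T (C_mult X h a) = T h * a x"
proof -
  have pos: "positive_functional X (C_fun X) T" using T by (simp add: state_space_iff)
  have aC: "a \<in> C_fun X" using a subset_C_fun by blast
  define u v where "u = C_real X (\<lambda>y. Re (h y))" and "v = C_real X (\<lambda>y. Im (h y))"
  have cont: "continuous_map X euclideanreal (\<lambda>y. Re (h y))"
    "continuous_map X euclideanreal (\<lambda>y. Im (h y))"
    using C_fun_continuous[OF h] by (simp_all add: continuous_map_Re continuous_map_Im)
  have uv: "u \<in> C_fun X" "v \<in> C_fun X"
    unfolding u_def v_def by (intro C_real_mem[OF compact] cont)+
  have h_eq: "h = C_add X u (C_scale X \<i> v)"
    unfolding u_def v_def by (rule C_decompose[OF C_fun_extensional[OF h]])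
  have "C_mult X (C_add X u (C_scale X \<i> v)) a = C_add X (C_mult X u a) (C_scale X \<i> (C_mult X v a))"
    by (rule C_eqI[of _ X]) (auto simp: C_apply algebra_simps)
  then have "T (C_mult X h a) = T (C_mult X u a) + \<i> * T (C_mult X v a)"
    using uv aC
    by (simp add: h_eq positive_functionalD[OF pos] C_scale_mem[OF compact] C_mult_mem[OF compact])
  also have "T (C_mult X u a) = T u * a x"
    unfolding u_def by (rule choquet_boundary_multiplicative_real[OF x T eval cont(1) a])
  also have "T (C_mult X v a) = T v * a x"
    unfolding v_def by (rule choquet_boundary_multiplicative_real[OF x T eval cont(2) a])
  also have "T u * a x + \<i> * (T v * a x) = T h * a x"
    using uv by (simp add: h_eq positive_functionalD[OF pos] C_scale_mem[OF compact] algebra_simps)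
  finally show ?thesis .
qed

text \<open>The elements \<open>a\<close> with \<open>T (h a) = T h a(x)\<close> for all \<open>h\<close> form a closed *-subalgebra.  It contains \<open>M\<close> by
  \<open>choquet_boundary_multiplicative\<close>, hence everything that \<open>M\<close> generates, and \<open>h = 1\<close> gives \<open>T f = f(x)\<close>.  This is where the
  hypothesis that the function system generates \<open>C(X)\<close> enters.\<close>

theorem choquet_boundary_imp_unique_extension:
  assumes gen: "generates_C X M" and x: "x \<in> choquet_boundary X M"
  shows "unique_extension X M x"
  unfolding unique_extension_def
proof (intro ballI impI)
  interpret C: function_system X "C_fun X" by (rule function_system_C_fun[OF compact])
  fix T f assume T: "T \<in> state_space X (C_fun X)" and eval: "\<forall>a\<in>M. T a = a x" and f: "f \<in> C_fun X"
  have xX: "x \<in> topspace X" using x by (simp add: choquet_boundary_def)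
  have pos: "positive_functional X (C_fun X) T" and T1: "T (C_const X 1) = 1"
    using T by (auto simp: state_space_iff)
  note mem = C_mult_mem[OF compact] C_add_mem[OF compact] C_scale_mem[OF compact] C_star_mem[OF compact]
  define B where "B = {a \<in> C_fun X. \<forall>h\<in>C_fun X. T (C_mult X h a) = T h * a x}"
  have "closedin (mtopology_of (C_metric X)) B"
  proof -
    have "a \<in> B" if a: "a \<in> mtopology_of (C_metric X) closure_of B" for a
    proof -
      have aC: "a \<in> C_fun X"
        and approx: "\<And>e. 0 < e \<Longrightarrow> \<exists>g\<in>B. \<forall>x\<in>topspace X. cmod (a x - g x) \<le> e"
        using a closure_of_C_metric[of B X] by (auto simp: B_def)
      have "T (C_mult X h a) = T h * a x" if h: "h \<in> C_fun X" for h
      proof -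
        obtain K where K: "0 \<le> K" "\<And>x. x \<in> topspace X \<Longrightarrow> cmod (h x) \<le> K"
          using real_continuous_bounded[OF compact continuous_map_norm[OF C_fun_continuous[OF h]]]
          by auto
        have Th: "cmod (T h) \<le> K" by (rule C.state_norm_le[OF T h K(2)])
        have "cmod (T (C_mult X h a) - T h * a x) \<le> e" if "0 < e" for e
        proof -
          have "0 < e / (2 * (K + 1))" using K(1) that by simp
          then obtain g where g: "g \<in> B"
            "\<And>x. x \<in> topspace X \<Longrightarrow> cmod (a x - g x) \<le> e / (2 * (K + 1))"
            using approx by blast
          have gC: "g \<in> C_fun X" using g(1) by (simp add: B_def)
          have bound: "z * cmod (a y - g y) \<le> e / 2" if "z \<le> K" "0 \<le> z" "y \<in> topspace X" for y z
          proof -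
            have "z * cmod (a y - g y) \<le> (K + 1) * (e / (2 * (K + 1)))"
              using that K(1) by (intro mult_mono g(2)) auto
            also have "\<dots> = e / 2" using K(1) by (simp add: field_simps)
            finally show ?thesis .
          qed
          have "cmod (T (C_mult X h a) - T (C_mult X h g)) \<le> e / 2"
          proof (rule C.state_diff_le[OF T mem(1)[OF h aC] mem(1)[OF h gC]])
            fix y assume y: "y \<in> topspace X"
            have "C_mult X h a y - C_mult X h g y = h y * (a y - g y)"
              using y by (simp add: C_apply algebra_simps)
            then show "cmod (C_mult X h a y - C_mult X h g y) \<le> e / 2"
              using bound[OF K(2)[OF y] norm_ge_zero y] by (simp add: norm_mult)
          qed
          moreover have "cmod (T h * (g x - a x)) \<le> e / 2"
            using bound[OF Th norm_ge_zero xX] by (simp add: norm_mult norm_minus_commute)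
          ultimately have "cmod (T (C_mult X h a) - T (C_mult X h g) + T h * (g x - a x)) \<le> e / 2 + e / 2"
            by (rule norm_triangle_mono)
          moreover have "T (C_mult X h g) = T h * g x" using g(1) h by (simp add: B_def)
          ultimately show ?thesis by (simp add: right_diff_distrib)
        qed
        then show ?thesis by (rule eq_if_norm_le_all)
      qed
      then show ?thesis using aC by (simp add: B_def)
    qed
    moreover have "B \<subseteq> topspace (mtopology_of (C_metric X))"
      by (auto simp: B_def C_fun_def)
    ultimately show ?thesis by (intro closure_of_subset_eq[THEN iffD1]) blast
  qed
  moreover have "C_const X 0 \<in> B"
  proof -
    have "C_mult X h (C_const X 0) = C_scale X 0 h" for h
      by (rule C_eqI[of _ X]) (auto simp: C_apply)
    then show ?thesis using C.const_mem xX by (simp add: B_def C_apply positive_functionalD[OF pos])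
  qed
  moreover have "C_add X a b \<in> B" if "a \<in> B" "b \<in> B" for a b
  proof -
    have "C_mult X h (C_add X a b) = C_add X (C_mult X h a) (C_mult X h b)" for h
      by (rule C_eqI[of _ X]) (auto simp: C_apply algebra_simps)
    then show ?thesis using that xX
      by (simp add: B_def C_apply positive_functionalD[OF pos] mem algebra_simps)
  qed
  moreover have "C_mult X a b \<in> B" if "a \<in> B" "b \<in> B" for a b
  proof -
    have "C_mult X h (C_mult X a b) = C_mult X (C_mult X h a) b" for h
      by (rule C_eqI[of _ X]) (auto simp: C_apply)
    then show ?thesis using that xX by (simp add: B_def C_apply mem)
  qed
  moreover have "C_star X a \<in> B" if "a \<in> B" for a
  proof -
    have "C_mult X h (C_star X a) = C_star X (C_mult X (C_star X h) a)" for h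
      by (rule C_eqI[of _ X]) (auto simp: C_apply)
    then show ?thesis using that xX
      by (simp add: B_def C_apply mem C.functional_star[OF pos])
  qed
  moreover have "C_scale X c a \<in> B" if "a \<in> B" for a c
  proof -
    have "C_mult X h (C_scale X c a) = C_scale X c (C_mult X h a)" for h
      by (rule C_eqI[of _ X]) (auto simp: C_apply)
    then show ?thesis using that xX
      by (simp add: B_def C_apply positive_functionalD[OF pos] mem)
  qed
  ultimately have "cstar_subalgebra X B" by (auto simp: cstar_subalgebra_def B_def)
  moreover have "M \<subseteq> B"
    using subset_C_fun choquet_boundary_multiplicative[OF x T] eval by (auto simp: B_def)
  ultimately have "cstar_subalgebra X hull M \<subseteq> B" by (intro hull_minimal)
  then have "f \<in> B" using gen f by (auto simp: generates_C_def)
  then have "T (C_mult X (C_const X 1) f) = f x"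
    using C.one_mem T1 by (auto simp: B_def)
  moreover have "C_mult X (C_const X 1) f = f"
    using C_fun_extensional[OF f] by (intro C_eqI[of _ X]) (auto simp: C_apply)
  ultimately show "T f = f x" by simp
qed

end

text \<open>Evaluation at a point is extreme among the states of the whole algebra: the function \<open>d = |g - g(x)|\<close> is
  nonnegative and vanishes at \<open>x\<close>, so both states in a convex decomposition vanish at \<open>d\<close>, which bounds
  their values at \<open>g - g(x)\<close>.\<close>

lemma point_evaluation_extreme:
  assumes X: "compact_space X" and x: "x \<in> topspace X"
    and T: "T \<in> state_space X (C_fun X)" and U: "U \<in> state_space X (C_fun X)"
    and r: "0 < r" "r < (1::real)"
    and eq: "\<And>f. f \<in> C_fun X \<Longrightarrow> f x = of_real r * T f + of_real (1 - r) * U f"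
    and f: "f \<in> C_fun X"
  shows "T f = f x"
proof -
  interpret C: function_system X "C_fun X" by (rule function_system_C_fun[OF X])
  have posT: "positive_functional X (C_fun X) T" and posU: "positive_functional X (C_fun X) U"
    using T U by (auto simp: state_space_iff)
  have real: "Re (T (C_real X g)) = g x" if g: "continuous_map X euclideanreal g" for g
  proof -
    define d where "d y = \<bar>g y - g x\<bar>" for y
    have d: "continuous_map X euclideanreal d"
      unfolding d_def[abs_def] by (intro continuous_map_real_abs continuous_map_diff g) simp
    note dC = C_real_mem[OF X d]
    have "0 \<le> Re (U (C_real X d))" "0 \<le> Re (T (C_real X d))"
      using positive_functionalD(3)[OF posU dC] positive_functionalD(3)[OF posT dC]
      by (auto simp: d_def complex_nonneg_Reals_iff)
    moreover have "r * Re (T (C_real X d)) + (1 - r) * Re (U (C_real X d)) = 0"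
      using arg_cong[OF eq[OF dC], of Re] x by (simp add: C_apply d_def)
    ultimately have "Re (T (C_real X d)) = 0"
      using r by (simp add: add_nonneg_eq_0_iff)
    moreover have "Re (T (C_real X (\<lambda>y. g y + - g x))) \<le> Re (T (C_real X d))"
      "Re (T (C_real X (\<lambda>y. g x + - 1 * g y))) \<le> Re (T (C_real X d))"
      by (auto intro!: C.functional_real_mono[OF posT] dC C_real_mem[OF X] continuous_map_diff g
        simp: d_def)
    ultimately show ?thesis
      using C.functional_real_add[OF posT C_real_mem[OF X g] C.real_const_mem, of "- g x"]
        C.functional_real_add[OF posT C.real_const_mem C.real_scale_mem[OF C_real_mem[OF X g]], of "g x" "- 1"]
        C.functional_real_scale[OF posT C_real_mem[OF X g], of "- 1"]
        C.state_real_const[OF T]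
      by simp
  qed
  show ?thesis
    using C.functional_decompose[OF posT f] C_fun_continuous[OF f]
    by (simp add: complex_eq_iff real continuous_map_Re continuous_map_Im)
qed

lemma (in function_system) point_state_in_state_space:
  "x \<in> topspace X \<Longrightarrow> point_state M x \<in> state_space X M"
  using one_mem
  by (auto simp: state_space_def point_state_def add_mem scale_mem C_apply C_nonneg_def)

text \<open>Extend both states of a convex decomposition to \<open>C(X)\<close>.  The combination of the extensions extends the
  point state, so by uniqueness it is evaluation at \<open>x\<close>, which is extreme.\<close>

lemma (in function_system) unique_extension_imp_choquet_boundary:
  assumes uniq: "unique_extension X M x" and x: "x \<in> topspace X"
  shows "x \<in> choquet_boundary X M"
proof -
  interpret C: function_system X "C_fun X" by (rule function_system_C_fun[OF compact])
  have zero: "continuous_map X euclideanreal (\<lambda>_. 0)" by simp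
  have "point_state M x \<in> state_space X M"
    by (rule point_state_in_state_space[OF x])
  moreover have "t = point_state M x \<and> u = point_state M x"
    if t: "t \<in> state_space X M" and u: "u \<in> state_space X M" and r: "0 < r" "r < 1"
      and eq: "point_state M x = (\<lambda>a\<in>M. of_real r * t a + of_real (1 - r) * u a)"
    for t u and r :: real
  proof -
    obtain T where T: "T \<in> state_space X (C_fun X)" "\<And>a. a \<in> M \<Longrightarrow> T a = t a"
      using state_extension[OF t zero] by blast
    obtain U where U: "U \<in> state_space X (C_fun X)" "\<And>a. a \<in> M \<Longrightarrow> U a = u a"
      using state_extension[OF u zero] by blast
    define V where "V = (\<lambda>f\<in>C_fun X. of_real r * T f + of_real (1 - r) * U f)"
    have nonneg: "of_real s * z \<in> \<real>\<^sub>\<ge>\<^sub>0" if "0 \<le> s" "z \<in> \<real>\<^sub>\<ge>\<^sub>0" for s and z :: complex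
      using that by (intro nonneg_Reals_mult_I) auto
    have "V \<in> state_space X (C_fun X)"
      unfolding state_space_def
    proof (intro CollectI conjI ballI allI impI)
      fix f assume f: "f \<in> C_fun X"
      show "V (C_add X f g) = V f + V g" if g: "g \<in> C_fun X" for g
        using T(1) U(1) f g C.add_mem[OF f g]
        by (simp add: V_def state_space_def algebra_simps)
      show "V (C_scale X c f) = c * V f" for c
        using T(1) U(1) f C.scale_mem[OF f]
        by (simp add: V_def state_space_def algebra_simps)
      show "V f \<in> \<real>\<^sub>\<ge>\<^sub>0" if "C_nonneg X f"
        using T(1) U(1) f that r unfolding V_def state_space_def
        by (auto simp del: of_real_diff intro!: nonneg_Reals_add_I nonneg)
    qed (use T(1) U(1) C.one_mem in \<open>auto simp: V_def state_space_def\<close>)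
    moreover have "V a = a x" if "a \<in> M" for a
      using fun_cong[OF eq, of a] that T(2) U(2) subset_C_fun by (auto simp: V_def point_state_def)
    ultimately have V: "f x = of_real r * T f + of_real (1 - r) * U f" if "f \<in> C_fun X" for f
      using uniq that by (auto simp: unique_extension_def V_def)
    have "T f = f x" "U f = f x" if f: "f \<in> C_fun X" for f
      using point_evaluation_extreme[OF compact x T(1) U(1) r V f]
        point_evaluation_extreme[OF compact x U(1) T(1), of "1 - r", OF _ _ _ f] r V
      by (auto simp: add.commute)
    then have "t a = point_state M x a" "u a = point_state M x a" for a
      using T(2)[of a] U(2)[of a] subset_C_fun t u
      by (cases "a \<in> M"; auto simp: point_state_def state_space_def extensional_def)+
    then show ?thesis by blast
  qed
  ultimately show ?thesis
    using x unfolding choquet_boundary_def extreme_state_def by blast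
qed

section \<open>Convergence of positive maps from uniqueness of extensions\<close>

text \<open>Some extension of the point state takes the value \<open>inf {a(x) | a \<in> M real, f \<le> a}\<close> at \<open>f\<close>.  If the only
  extension is evaluation at \<open>x\<close>, this infimum is \<open>f(x)\<close>.\<close>

lemma (in function_system) unique_extension_upper:
  assumes uniq: "unique_extension X M x" and x: "x \<in> topspace X"
    and f: "continuous_map X euclideanreal f" and e: "0 < e"
  obtains a where "C_real X a \<in> M" "\<And>y. y \<in> topspace X \<Longrightarrow> f y \<le> a y" "a x < f x + e"
proof -
  define V where "V = {Re (point_state M x (C_real X a)) | a. C_real X a \<in> M \<and> (\<forall>y\<in>topspace X. f y \<le> a y)}"
  obtain T where T: "T \<in> state_space X (C_fun X)" "\<And>a. a \<in> M \<Longrightarrow> T a = point_state M x a"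
      "Re (T (C_real X f)) = Inf V"
    unfolding V_def using state_extension[OF point_state_in_state_space[OF x] f] by blast
  have "T (C_real X f) = C_real X f x"
    using uniq T(1,2) C_real_mem[OF compact f] by (auto simp: unique_extension_def point_state_def)
  then have "Inf V < f x + e" using T(3) x e by (simp add: C_apply)
  moreover have "V \<noteq> {}"
  proof -
    obtain c where "0 \<le> c" "\<And>y. y \<in> topspace X \<Longrightarrow> \<bar>f y\<bar> \<le> c"
      using real_continuous_bounded[OF compact f] by blast
    then show ?thesis using real_const_mem[of c] by (force simp: V_def)
  qed
  ultimately obtain v where "v \<in> V" "v < f x + e" using cInf_lessD by blast
  then show thesis using that x by (auto simp: V_def point_state_def C_apply)
qed

lemma (in function_system) unique_extension_sandwich:
  assumes uniq: "unique_extension X M x" and x: "x \<in> topspace X"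
    and f: "continuous_map X euclideanreal f" and e: "0 < e"
  obtains a b where "C_real X a \<in> M" "C_real X b \<in> M"
    "\<And>y. y \<in> topspace X \<Longrightarrow> b y \<le> f y \<and> f y \<le> a y" "a x - b x < e"
proof -
  obtain a where a: "C_real X a \<in> M" "\<And>y. y \<in> topspace X \<Longrightarrow> f y \<le> a y" "a x < f x + e / 2"
    using unique_extension_upper[OF uniq x f, of "e / 2"] e by auto
  obtain b where b: "C_real X b \<in> M" "\<And>y. y \<in> topspace X \<Longrightarrow> - f y \<le> b y" "b x < - f x + e / 2"
    using unique_extension_upper[OF uniq x continuous_map_minus[OF f], of "e / 2"] e by auto
  show thesis
    using a b real_scale_mem[OF b(1), of "- 1"] by (intro that[of a "\<lambda>y. - b y"]) force+
qed

lemma compact_space_neighbourhood_cover: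
  assumes X: "compact_space X"
    and U: "\<And>x. x \<in> topspace X \<Longrightarrow> openin X (U x)" "\<And>x. x \<in> topspace X \<Longrightarrow> x \<in> U x"
  obtains F where "finite F" "F \<subseteq> topspace X" "topspace X \<subseteq> \<Union> (U ` F)"
proof -
  have "\<forall>V\<in>U ` topspace X. openin X V" "topspace X \<subseteq> \<Union> (U ` topspace X)"
    using U by auto
  then obtain \<V> where \<V>: "finite \<V>" "\<V> \<subseteq> U ` topspace X" "topspace X \<subseteq> \<Union> \<V>"
    using X unfolding compact_space_alt by meson
  obtain F where "F \<subseteq> topspace X" "finite F" "\<V> = U ` F"
    using finite_subset_image[OF \<V>(1,2)] by blast
  then show thesis using that \<V>(3) by blast
qed

lemma linear_CD:
  assumes "linear_C X Y \<phi>" "f \<in> C_fun X"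
  shows "\<phi> f \<in> C_fun Y" "g \<in> C_fun X \<Longrightarrow> \<phi> (C_add X f g) = C_add Y (\<phi> f) (\<phi> g)"
    "\<phi> (C_scale X c f) = C_scale Y c (\<phi> f)"
  using assms by (auto simp: linear_C_def)

text \<open>If \<open>f \<mapsto> \<pi> f (y)\<close> is not evaluation at any point, then around each \<open>x\<close> some function \<open>d x\<close> in its kernel has no
  zeros.  By compactness a finite sum of the functions \<open>|d x|\<^sup>2\<close> is invertible, yet it lies in the kernel,
  and so \<open>1\<close> is in the kernel as well.\<close>

theorem star_hom_point_evaluation:
  assumes X: "compact_space X" and hom: "unital_star_hom X Y \<pi>" and y: "y \<in> topspace Y"
  obtains x where "x \<in> topspace X" "\<And>f. f \<in> C_fun X \<Longrightarrow> \<pi> f y = f x"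
proof (rule ccontr)
  interpret C: function_system X "C_fun X" by (rule function_system_C_fun[OF X])
  note mem = C_mult_mem[OF X] C.add_mem C.scale_mem C.star_mem C.const_mem
  have lin: "linear_C X Y \<pi>" using hom by (simp add: unital_star_hom_def)
  have add: "\<pi> (C_add X f g) y = \<pi> f y + \<pi> g y" if "f \<in> C_fun X" "g \<in> C_fun X" for f g
    using linear_CD(2)[OF lin that] y by (simp add: C_apply)
  have scale: "\<pi> (C_scale X c f) y = c * \<pi> f y" if "f \<in> C_fun X" for f c
    using linear_CD(3)[OF lin that] y by (simp add: C_apply)
  have mult: "\<pi> (C_mult X f g) y = \<pi> f y * \<pi> g y" if "f \<in> C_fun X" "g \<in> C_fun X" for f g
    using hom that y by (simp add: unital_star_hom_def C_apply)
  have one: "\<pi> (C_const X 1) y = 1"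
    using hom y by (simp add: unital_star_hom_def C_apply)
  assume "\<not> thesis"
  then have "\<forall>x\<in>topspace X. \<exists>f\<in>C_fun X. \<pi> f y \<noteq> f x" using that by blast
  then obtain w where w: "\<And>x. x \<in> topspace X \<Longrightarrow> w x \<in> C_fun X"
    "\<And>x. x \<in> topspace X \<Longrightarrow> \<pi> (w x) y \<noteq> w x x" by metis
  define d where "d x = C_add X (w x) (C_scale X (- \<pi> (w x) y) (C_const X 1))" for x
  have d: "d x \<in> C_fun X" if "x \<in> topspace X" for x
    using w(1)[OF that] by (simp add: d_def mem)
  have d0: "\<pi> (d x) y = 0" if "x \<in> topspace X" for x
    using w(1)[OF that] by (simp add: d_def mem add scale one)
  have dx: "d x x \<noteq> 0" if "x \<in> topspace X" for x
    using w(2)[OF that] that by (simp add: d_def C_apply)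
  define U where "U x = {z \<in> topspace X. d x z \<in> - {0}}" for x
  have U: "openin X (U x)" if "x \<in> topspace X" for x
    unfolding U_def by (intro openin_continuous_map_preimage[OF C_fun_continuous[OF d[OF that]]]) auto
  have xU: "x \<in> U x" if "x \<in> topspace X" for x using dx that by (simp add: U_def)
  obtain F where F: "finite F" "F \<subseteq> topspace X" "topspace X \<subseteq> \<Union> (U ` F)"
    by (rule compact_space_neighbourhood_cover[OF X, of U]) (use U xU in auto)
  define s where "s F z = (\<Sum>x\<in>F. (cmod (d x z))\<^sup>2)" for F z
  have s_cont: "continuous_map X euclideanreal (s F)" if "F \<subseteq> topspace X" "finite F" for F
    unfolding s_def[abs_def] using that d
    by (intro continuous_map_sum continuous_map_real_pow continuous_map_norm C_fun_continuous) auto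
  have s0: "\<pi> (C_real X (s F)) y = 0" if "finite F" "F \<subseteq> topspace X" for F
    using that
  proof (induction F rule: finite_induct)
    case empty
    have "C_real X (s {}) = C_scale X 0 (C_const X 1)"
      by (rule C_eqI[of _ X]) (auto simp: C_apply s_def)
    then show ?case using mem by (simp add: scale)
  next
    case (insert x F)
    have "C_real X (s (insert x F)) = C_add X (C_mult X (C_star X (d x)) (d x)) (C_real X (s F))"
      using insert.hyps complex_norm_square[of "d x _"]
      by (intro C_eqI[of _ X]) (auto simp: C_apply s_def mult.commute)
    then show ?case
      using insert d[of x] d0[of x] C_real_mem[OF X s_cont[of F]] by (simp add: add mult mem)
  qed
  have s_pos: "s F z \<noteq> 0" if z: "z \<in> topspace X" for z
  proof -
    obtain x where "x \<in> F" "d x z \<noteq> 0" using subsetD[OF F(3) z] by (auto simp: U_def)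
    then show ?thesis using F(1) by (auto simp: s_def sum_nonneg_eq_0_iff)
  qed
  have inv: "continuous_map X euclideanreal (\<lambda>z. inverse (s F z))"
    using s_cont[OF F(2,1)] s_pos by (rule continuous_map_real_inverse)
  have "C_const X 1 = C_mult X (C_real X (s F)) (C_real X (\<lambda>z. inverse (s F z)))"
    using s_pos by (intro C_eqI[of _ X]) (auto simp: C_apply simp flip: of_real_mult)
  then have "(1::complex) = 0"
    using one s0[OF F(1,2)] mult[OF C_real_mem[OF X s_cont[OF F(2,1)]] C_real_mem[OF X inv]] by simp
  then show False by simp
qed

lemma positive_linear_C_at:
  assumes "positive_linear_C X Y \<phi>" and y: "y \<in> topspace Y"
  shows "positive_functional X (C_fun X) (\<lambda>f. \<phi> f y)"
  using assms linear_CD[of X Y \<phi>]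
  by (auto simp: positive_linear_C_def positive_functional_def C_apply C_nonneg_def)

lemma tendsto_C_metric_iff_uniform_limit:
  assumes h: "\<forall>\<^sub>F i in F. h i \<in> C_fun Y" and g: "g \<in> C_fun Y"
  shows "((\<lambda>i. mdist (C_metric Y) (h i) g) \<longlongrightarrow> 0) F \<longleftrightarrow> uniform_limit (topspace Y) h g F"
proof
  interpret Metric_space "C_fun Y" "mdist (C_metric Y)"
    unfolding C_fun_def by (rule Metric_space_mspace_mdist)
  assume L: "((\<lambda>i. mdist (C_metric Y) (h i) g) \<longlongrightarrow> 0) F"
  show "uniform_limit (topspace Y) h g F"
  proof (rule uniform_limitI)
    fix e :: real assume "0 < e"
    then have "\<forall>\<^sub>F i in F. mdist (C_metric Y) (h i) g < e" using order_tendstoD(2)[OF L] by blast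
    with h show "\<forall>\<^sub>F i in F. \<forall>y\<in>topspace Y. dist (h i y) (g y) < e"
      by eventually_elim (auto simp: dist_norm intro: le_less_trans[OF C_apply_dist_le[OF _ g]])
  qed
next
  assume L: "uniform_limit (topspace Y) h g F"
  show "((\<lambda>i. mdist (C_metric Y) (h i) g) \<longlongrightarrow> 0) F"
  proof (rule tendstoI)
    fix e :: real assume e: "0 < e"
    then have "0 < e / 2" by simp
    from h uniform_limitD[OF L this] show "\<forall>\<^sub>F i in F. dist (mdist (C_metric Y) (h i) g) 0 < e"
    proof eventually_elim
      case (elim i)
      then have "mdist (C_metric Y) (h i) g \<le> e / 2"
        using e g by (intro C_dist_le) (auto simp: dist_norm less_imp_le)
      moreover have "0 \<le> mdist (C_metric Y) (h i) g" by simp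
      ultimately show ?case using e by simp
    qed
  qed
qed

text \<open>The maps \<open>\<phi> i\<close> are positive only eventually, because a net is represented by its filter, and the filter
  only sees tails of the index set.\<close>

locale positive_net =
  fixes X :: "'a topology" and Y :: "'b topology"
    and \<phi> :: "'i \<Rightarrow> ('a \<Rightarrow> complex) \<Rightarrow> ('b \<Rightarrow> complex)" and \<pi> and F :: "'i filter"
  assumes X: "compact_space X" and hom: "unital_star_hom X Y \<pi>"
    and pos: "\<forall>\<^sub>F i in F. positive_linear_C X Y (\<phi> i)"
begin

definition limit_set :: "('a \<Rightarrow> complex) set" where
  "limit_set = {f \<in> C_fun X. uniform_limit (topspace Y) (\<lambda>i. \<phi> i f) (\<pi> f) F}"

lemma linear_hom: "linear_C X Y \<pi>"
  and eventually_linear: "\<forall>\<^sub>F i in F. linear_C X Y (\<phi> i)"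
  using hom pos by (auto simp: unital_star_hom_def positive_linear_C_def elim: eventually_mono)

lemma limit_set_add:
  assumes "f \<in> limit_set" "g \<in> limit_set"
  shows "C_add X f g \<in> limit_set"
proof -
  have fg: "f \<in> C_fun X" "g \<in> C_fun X" using assms by (auto simp: limit_set_def)
  have "uniform_limit (topspace Y) (\<lambda>i y. \<phi> i f y + \<phi> i g y) (\<lambda>y. \<pi> f y + \<pi> g y) F"
    using assms by (intro uniform_limit_add) (auto simp: limit_set_def)
  also have "?this \<longleftrightarrow> uniform_limit (topspace Y) (\<lambda>i. \<phi> i (C_add X f g)) (\<pi> (C_add X f g)) F"
    by (intro uniform_limit_cong eventually_mono[OF eventually_linear])
      (auto simp: linear_CD[OF linear_hom] linear_CD fg C_apply)
  finally show ?thesis using fg by (simp add: limit_set_def C_add_mem[OF X])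
qed

lemma limit_set_scale:
  assumes "f \<in> limit_set"
  shows "C_scale X c f \<in> limit_set"
proof -
  have f: "f \<in> C_fun X" using assms by (auto simp: limit_set_def)
  have "uniform_limit (topspace Y) (\<lambda>i y. c * \<phi> i f y) (\<lambda>y. c * \<pi> f y) F"
    using assms by (intro uniform_limit_intros) (auto simp: limit_set_def)
  also have "?this \<longleftrightarrow> uniform_limit (topspace Y) (\<lambda>i. \<phi> i (C_scale X c f)) (\<pi> (C_scale X c f)) F"
    by (intro uniform_limit_cong eventually_mono[OF eventually_linear])
      (auto simp: linear_CD[OF linear_hom] linear_CD f C_apply)
  finally show ?thesis using f by (simp add: limit_set_def C_scale_mem[OF X])
qed

lemma limit_set_star:
  assumes "f \<in> limit_set"
  shows "C_star X f \<in> limit_set"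
proof -
  interpret C: function_system X "C_fun X" by (rule function_system_C_fun[OF X])
  have f: "f \<in> C_fun X" using assms by (auto simp: limit_set_def)
  have "uniform_limit (topspace Y) (\<lambda>i y. cnj (\<phi> i f y)) (\<lambda>y. cnj (\<pi> f y)) F"
    using assms by (intro uniform_limit_intros) (auto simp: limit_set_def)
  also have "?this \<longleftrightarrow> uniform_limit (topspace Y) (\<lambda>i. \<phi> i (C_star X f)) (\<pi> (C_star X f)) F"
    using hom
    by (intro uniform_limit_cong eventually_mono[OF pos])
      (auto simp: C.functional_star[OF positive_linear_C_at f] unital_star_hom_def f C_apply)
  finally show ?thesis using f by (simp add: limit_set_def C_star_mem[OF X])
qed

text \<open>Let \<open>f\<close> be real.  By uniqueness every point \<open>x\<close> has \<open>b \<le> f \<le> a\<close> with \<open>a, b\<close> in \<open>M\<close> and \<open>a - b\<close> small near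
  \<open>x\<close>; finitely many such pairs serve all of \<open>X\<close>.  Eventually \<open>\<phi> i\<close> is uniformly close to \<open>\<pi>\<close> on these
  finitely many functions.  At a point \<open>y\<close> the homomorphism is evaluation at some \<open>z\<close>, and the pair belonging
  to \<open>z\<close> traps \<open>\<phi> i f (y)\<close> between \<open>\<phi> i b (y)\<close> and \<open>\<phi> i a (y)\<close>, both close to \<open>f(z)\<close>.\<close>

lemma limit_set_eq_C_fun:
  assumes M: "function_system X M" "M \<subseteq> limit_set"
    and uniq: "\<And>x. x \<in> topspace X \<Longrightarrow> unique_extension X M x"
  shows "limit_set = C_fun X"
proof -
  interpret M: function_system X M by (rule M(1))
  interpret C: function_system X "C_fun X" by (rule function_system_C_fun[OF X])
  have real: "C_real X f \<in> limit_set" if f: "continuous_map X euclideanreal f" for f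
  proof -
    note fC = C_real_mem[OF X f]
    have "\<forall>\<^sub>F i in F. \<forall>y\<in>topspace Y. dist (\<phi> i (C_real X f) y) (\<pi> (C_real X f) y) < e"
      if "0 < e" for e :: real
    proof -
      define \<delta> where "\<delta> = e / 2"
      have \<delta>: "0 < \<delta>" using that by (simp add: \<delta>_def)
      have "\<forall>x\<in>topspace X. \<exists>a b. C_real X a \<in> M \<and> C_real X b \<in> M \<and>
          (\<forall>y\<in>topspace X. b y \<le> f y \<and> f y \<le> a y) \<and> a x - b x < \<delta>"
        using M.unique_extension_sandwich[OF uniq _ f \<delta>] by metis
      then obtain a b where ab: "\<And>x. x \<in> topspace X \<Longrightarrow> C_real X (a x) \<in> M"
        "\<And>x. x \<in> topspace X \<Longrightarrow> C_real X (b x) \<in> M"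
        "\<And>x y. x \<in> topspace X \<Longrightarrow> y \<in> topspace X \<Longrightarrow> b x y \<le> f y \<and> f y \<le> a x y"
        "\<And>x. x \<in> topspace X \<Longrightarrow> a x x - b x x < \<delta>"
        by metis
      have ab_cont: "continuous_map X euclideanreal (a x)" "continuous_map X euclideanreal (b x)"
        if "x \<in> topspace X" for x
        using ab(1,2)[OF that] M.subset_C_fun C_real_continuousD by blast+
      define U where "U x = {z \<in> topspace X. a x z - b x z \<in> {..<\<delta>}}" for x
      have U: "openin X (U x)" if "x \<in> topspace X" for x
        unfolding U_def
        by (intro openin_continuous_map_preimage[OF continuous_map_diff[OF ab_cont[OF that]]]) auto
      have xU: "x \<in> U x" if "x \<in> topspace X" for x using ab(4) that by (simp add: U_def)
      obtain S where S: "finite S" "S \<subseteq> topspace X" "topspace X \<subseteq> \<Union> (U ` S)"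
        by (rule compact_space_neighbourhood_cover[OF X, of U]) (use U xU in auto)
      have close: "\<forall>\<^sub>F i in F. \<forall>y\<in>topspace Y. dist (\<phi> i g y) (\<pi> g y) < \<delta>" if "g \<in> M" for g
        using that M(2) by (intro uniform_limitD[OF _ \<delta>]) (auto simp: limit_set_def)
      have "\<forall>\<^sub>F i in F. \<forall>x\<in>S. (\<forall>y\<in>topspace Y. dist (\<phi> i (C_real X (a x)) y) (\<pi> (C_real X (a x)) y) < \<delta>) \<and>
          (\<forall>y\<in>topspace Y. dist (\<phi> i (C_real X (b x)) y) (\<pi> (C_real X (b x)) y) < \<delta>)"
        using S(1,2) ab(1,2) by (intro eventually_ball_finite ballI eventually_conj close) auto
      with pos show ?thesis
      proof eventually_elim
        case (elim i)
        show ?case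
        proof
          fix y assume y: "y \<in> topspace Y"
          obtain z where z: "z \<in> topspace X" "\<And>g. g \<in> C_fun X \<Longrightarrow> \<pi> g y = g z"
            using star_hom_point_evaluation[OF X hom y] by blast
          obtain x where x: "x \<in> S" "z \<in> U x" using S(3) z(1) by blast
          then have xX: "x \<in> topspace X" using S(2) by blast
          have T: "positive_functional X (C_fun X) (\<lambda>g. \<phi> i g y)"
            by (rule positive_linear_C_at[OF elim(1) y])
          have aC: "C_real X (a x) \<in> C_fun X" and bC: "C_real X (b x) \<in> C_fun X"
            using ab(1,2)[OF xX] M.subset_C_fun by auto
          have "Re (\<phi> i (C_real X (b x)) y) \<le> Re (\<phi> i (C_real X f) y)"
            "Re (\<phi> i (C_real X f) y) \<le> Re (\<phi> i (C_real X (a x)) y)"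
            using ab(3)[OF xX]
              by (auto intro: C.functional_real_mono[OF T bC fC] C.functional_real_mono[OF T fC aC])
          moreover have "\<bar>Re (\<phi> i (C_real X (a x)) y) - a x z\<bar> < \<delta>"
            "\<bar>Re (\<phi> i (C_real X (b x)) y) - b x z\<bar> < \<delta>"
            using elim(2) x(1) y z aC bC abs_Re_le_cmod[of "\<phi> i (C_real X (a x)) y - a x z"]
              abs_Re_le_cmod[of "\<phi> i (C_real X (b x)) y - b x z"]
            by (force simp: dist_norm C_apply)+
          moreover have "a x z - b x z < \<delta>" using x(2) by (simp add: U_def)
          moreover have "b x z \<le> f z" "f z \<le> a x z" using ab(3)[OF xX z(1)] by auto
          ultimately have "\<bar>Re (\<phi> i (C_real X f) y) - f z\<bar> < e"
            unfolding \<delta>_def by linarith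
          moreover have "\<phi> i (C_real X f) y = of_real (Re (\<phi> i (C_real X f) y))"
            using C.functional_real_in_Reals[OF T fC] by (simp add: of_real_Re)
          ultimately show "dist (\<phi> i (C_real X f) y) (\<pi> (C_real X f) y) < e"
            using z fC by (metis C_apply(6) dist_of_real dist_real_def)
        qed
      qed
    qed
    then show ?thesis using fC by (auto simp: limit_set_def intro: uniform_limitI)
  qed
  have "f \<in> limit_set" if f: "f \<in> C_fun X" for f
  proof -
    have "C_add X (C_real X (\<lambda>x. Re (f x))) (C_scale X \<i> (C_real X (\<lambda>x. Im (f x)))) \<in> limit_set"
      by (intro limit_set_add limit_set_scale real continuous_map_Re continuous_map_Im C_fun_continuous f)
    then show ?thesis using C_decompose[OF C_fun_extensional[OF f]] by simp
  qed
  then show ?thesis by (auto simp: limit_set_def)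
qed

end

text \<open>The functions on which the net converges form a self-adjoint linear space containing \<open>G\<close>, so they contain
  the span of \<open>G \<union> G*\<close>, and \<open>limit_set_eq_C_fun\<close> applies to that span.\<close>

theorem unique_extension_imp_net_determined:
  assumes X: "compact_space X" and G: "G \<subseteq> C_fun X" and one: "C_const X 1 \<in> G"
    and uniq: "\<And>x. x \<in> topspace X \<Longrightarrow> unique_extension X (lin_span X (G \<union> C_star X ` G)) x"
    and hom: "unital_star_hom X Y \<pi>"
  shows "net_determined X Y \<pi> G"
  unfolding net_determined_def
proof (intro allI impI ballI, elim conjE)
  fix \<Lambda> :: "((('a \<Rightarrow> complex) \<Rightarrow> ('b \<Rightarrow> complex)) \<times> (('a \<Rightarrow> complex) \<Rightarrow> ('b \<Rightarrow> complex)) set) set"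
    and le \<phi> f
  assume dir: "directed_set \<Lambda> le" and pos: "\<forall>i\<in>\<Lambda>. positive_linear_C X Y (\<phi> i)"
    and conv: "\<forall>g\<in>G. ((\<lambda>i. mdist (C_metric Y) (\<phi> i g) (\<pi> g)) \<longlongrightarrow> 0) (net_filter \<Lambda> le)"
    and f: "f \<in> C_fun X"
  let ?F = "net_filter \<Lambda> le"
  let ?L = "lin_span X (G \<union> C_star X ` G)"
  interpret positive_net X Y \<phi> \<pi> ?F
    using X hom pos dir
    by unfold_locales (auto simp: eventually_net_filter[OF dir] directed_set_def)
  have mem: "\<forall>\<^sub>F i in ?F. \<phi> i g \<in> C_fun Y" "\<pi> g \<in> C_fun Y" if "g \<in> C_fun X" for g
    using linear_hom eventually_linear that by (auto elim!: eventually_mono dest: linear_CD(1))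
  have G_lim: "g \<in> limit_set" if "g \<in> G" for g
    using conv that G tendsto_C_metric_iff_uniform_limit[OF mem] by (auto simp: limit_set_def)
  have "C_scale X 0 (C_const X 1) = C_const X 0" by (rule C_eqI[of _ X]) (auto simp: C_apply)
  then have "C_const X 0 \<in> limit_set" using limit_set_scale[OF G_lim[OF one], of 0] by simp
  then have "?L \<subseteq> limit_set"
    using G_lim limit_set_add limit_set_scale limit_set_star by (intro lin_span_subset) auto
  then have "f \<in> limit_set"
    using limit_set_eq_C_fun[OF function_system_lin_span[OF X G one]] uniq f by blast
  then show "((\<lambda>i. mdist (C_metric Y) (\<phi> i f) (\<pi> f)) \<longlongrightarrow> 0) ?F"
    using tendsto_C_metric_iff_uniform_limit[OF mem[OF f]] by (auto simp: limit_set_def)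
qed

section \<open>Uniqueness of extensions from convergence of positive maps\<close>

text \<open>A state \<open>T\<close> that agrees with evaluation at \<open>x\<close> on \<open>G\<close> yields positive maps
  \<open>\<phi> U f = (1 - h U) f + T f h U\<close>, indexed by the open neighbourhoods of \<open>x\<close>, where \<open>h U\<close> is a bump
  function with \<open>h U (x) = 1\<close> that vanishes off \<open>U\<close>.  For \<open>g\<close> in \<open>G\<close> the error \<open>\<phi> U g - g = h U (g(x) - g)\<close> tends
  to \<open>0\<close> by continuity of \<open>g\<close> at \<open>x\<close>.  Hence \<open>\<phi> U f\<close> tends to \<open>f\<close> for every \<open>f\<close>, while \<open>\<phi> U f (x) = T f\<close>.\<close>

lemma net_determined_identity_imp_unique_extension:
  assumes X: "compact_space X" "Hausdorff_space X" and G: "G \<subseteq> C_fun X" "G \<subseteq> A"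
    and det: "net_determined X X (\<lambda>f. f) G" and x: "x \<in> topspace X"
  shows "unique_extension X A x"
  unfolding unique_extension_def
proof (intro ballI impI)
  interpret C: function_system X "C_fun X" by (rule function_system_C_fun[OF X(1)])
  fix T f assume T: "T \<in> state_space X (C_fun X)" and eval: "\<forall>a\<in>A. T a = a x" and f: "f \<in> C_fun X"
  have pos: "positive_functional X (C_fun X) T" using T by (simp add: state_space_iff)
  have "completely_regular_space X"
    using X normal_imp_completely_regular_space compact_Hausdorff_or_regular_imp_normal_space
    by blast
  define \<Lambda> where "\<Lambda> = {U. openin X U \<and> x \<in> U}"
  have "\<exists>h. continuous_map X euclideanreal h \<and> (\<forall>z\<in>topspace X. 0 \<le> h z \<and> h z \<le> 1) \<and>
      h x = 1 \<and> (\<forall>z\<in>topspace X - U. h z = 0)" if U: "U \<in> \<Lambda>" for U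
  proof -
    obtain k where k: "continuous_map X euclideanreal k" "k x = 0" "k ` (topspace X - U) \<subseteq> {1}"
      using \<open>completely_regular_space X\<close> U unfolding completely_regular_space_alt' \<Lambda>_def by blast
    have "continuous_map X euclideanreal (\<lambda>z. 1 - max 0 (min (k z) 1))"
      using k(1) by (intro continuous_map_diff continuous_map_real_max continuous_map_real_min) auto
    then show ?thesis
      using k(2,3) by (intro exI[of _ "\<lambda>z. 1 - max 0 (min (k z) 1)"]) auto
  qed
  then have "\<forall>U\<in>\<Lambda>. \<exists>h. continuous_map X euclideanreal h \<and> (\<forall>z\<in>topspace X. 0 \<le> h z \<and> h z \<le> 1) \<and>
      h x = 1 \<and> (\<forall>z\<in>topspace X - U. h z = 0)" by (rule ballI)
  from bchoice[OF this] obtain h where h': "\<forall>U\<in>\<Lambda>. continuous_map X euclideanreal (h U) \<and>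
      (\<forall>z\<in>topspace X. 0 \<le> h U z \<and> h U z \<le> 1) \<and> h U x = 1 \<and> (\<forall>z\<in>topspace X - U. h U z = 0)"
    by (rule exE)
  have h: "continuous_map X euclideanreal (h U)" "z \<in> topspace X \<Longrightarrow> 0 \<le> h U z \<and> h U z \<le> 1"
    "h U x = 1" "z \<in> topspace X \<Longrightarrow> z \<notin> U \<Longrightarrow> h U z = 0" if "U \<in> \<Lambda>" for U z
    using h' that by auto
  define le where "le U V \<longleftrightarrow> V \<subseteq> U" for U V :: "'a set"
  define \<phi> where "\<phi> U f = (\<lambda>z\<in>topspace X. of_real (1 - h U z) * f z + of_real (h U z) * T f)" for U f
  have dir: "directed_set \<Lambda> le"
    unfolding directed_set_def
  proof (intro conjI ballI)
    show "\<Lambda> \<noteq> {}" using x by (auto simp: \<Lambda>_def)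
    show "reflp_on \<Lambda> le" "transp_on \<Lambda> le"
      by (auto simp: le_def intro!: reflp_onI transp_onI)
    show "\<exists>W\<in>\<Lambda>. le U W \<and> le V W" if "U \<in> \<Lambda>" "V \<in> \<Lambda>" for U V
      using that by (intro bexI[of _ "U \<inter> V"]) (auto simp: \<Lambda>_def le_def)
  qed
  have \<phi>_C: "\<phi> U g \<in> C_fun X" if U: "U \<in> \<Lambda>" and g: "g \<in> C_fun X" for U g
  proof -
    have hU: "continuous_map X euclideanreal (h U)" by (rule h(1)[OF U])
    have "\<phi> U g = C_add X (C_mult X (C_real X (\<lambda>z. 1 - h U z)) g) (C_scale X (T g) (C_real X (h U)))"
      by (rule C_eqI[of _ X]) (auto simp: \<phi>_def C_apply)
    then show ?thesis
      using hU g by (simp add: C.add_mem C.scale_mem C_mult_mem[OF X(1)] C_real_mem[OF X(1)]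
        continuous_map_diff)
  qed
  have \<phi>_pos: "positive_linear_C X X (\<phi> U)" if U: "U \<in> \<Lambda>" for U
  proof -
    have nonneg: "of_real s * z \<in> \<real>\<^sub>\<ge>\<^sub>0" if "0 \<le> s" "z \<in> \<real>\<^sub>\<ge>\<^sub>0" for s and z :: complex
      using that by (intro nonneg_Reals_mult_I) auto
    have "\<phi> U (C_add X f g) = C_add X (\<phi> U f) (\<phi> U g)" if "f \<in> C_fun X" "g \<in> C_fun X" for f g
      using that by (intro C_eqI[of _ X])
        (auto simp: \<phi>_def C_apply positive_functionalD[OF pos] algebra_simps)
    moreover have "\<phi> U (C_scale X c f) = C_scale X c (\<phi> U f)" if "f \<in> C_fun X" for c f
      using that by (intro C_eqI[of _ X])
        (auto simp: \<phi>_def C_apply positive_functionalD[OF pos] algebra_simps)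
    moreover have "C_nonneg X (\<phi> U f)" if "f \<in> C_fun X" "C_nonneg X f" for f
      using that h(2)[OF U] positive_functionalD(3)[OF pos that(1)]
      by (auto simp: C_nonneg_def \<phi>_def simp del: of_real_diff intro!: nonneg_Reals_add_I nonneg)
    ultimately show ?thesis
      using \<phi>_C[OF U] by (auto simp: positive_linear_C_def linear_C_def)
  qed
  have \<phi>_lim: "((\<lambda>U. mdist (C_metric X) (\<phi> U g) g) \<longlongrightarrow> 0) (net_filter \<Lambda> le) \<longleftrightarrow>
      uniform_limit (topspace X) (\<lambda>U. \<phi> U g) g (net_filter \<Lambda> le)" if g: "g \<in> C_fun X" for g
  proof (rule tendsto_C_metric_iff_uniform_limit[OF _ g])
    show "\<forall>\<^sub>F U in net_filter \<Lambda> le. \<phi> U g \<in> C_fun X"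
      using dir \<phi>_C[OF _ g] by (auto simp: eventually_net_filter[OF dir] directed_set_def)
  qed
  have conv: "((\<lambda>U. mdist (C_metric X) (\<phi> U g) g) \<longlongrightarrow> 0) (net_filter \<Lambda> le)" if gG: "g \<in> G" for g
  proof -
    have g: "g \<in> C_fun X" and Tg: "T g = g x" using gG G eval by auto
    have "uniform_limit (topspace X) (\<lambda>U. \<phi> U g) g (net_filter \<Lambda> le)"
    proof (rule uniform_limitI)
      fix e :: real assume e: "0 < e"
      define U where "U = {z \<in> topspace X. g z \<in> ball (g x) e}"
      have "openin X U"
        unfolding U_def by (intro openin_continuous_map_preimage[OF C_fun_continuous[OF g]]) auto
      then have U: "U \<in> \<Lambda>" using x e by (simp add: \<Lambda>_def U_def)
      have "dist (\<phi> V g z) (g z) < e" if V: "V \<in> \<Lambda>" "V \<subseteq> U" and z: "z \<in> topspace X" for V z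
      proof -
        have "\<phi> V g z - g z = of_real (h V z) * (g x - g z)"
          using z by (simp add: \<phi>_def Tg algebra_simps)
        then have eq: "dist (\<phi> V g z) (g z) = \<bar>h V z\<bar> * dist (g x) (g z)"
          by (simp add: dist_norm norm_mult)
        show ?thesis
        proof (cases "z \<in> V")
          case True
          have "\<bar>h V z\<bar> * dist (g x) (g z) \<le> 1 * dist (g x) (g z)"
            using h(2)[OF V(1) z] by (intro mult_right_mono) auto
          also have "\<dots> < e" using True V by (auto simp: U_def)
          finally show ?thesis using eq by simp
        next
          case False
          then show ?thesis using eq h(4)[OF V(1) z] e by simp
        qed
      qed
      then show "\<forall>\<^sub>F V in net_filter \<Lambda> le. \<forall>z\<in>topspace X. dist (\<phi> V g z) (g z) < e"
        unfolding eventually_net_filter[OF dir] using U by (auto simp: le_def)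
    qed
    then show ?thesis using \<phi>_lim[OF g] by simp
  qed
  have "((\<lambda>U. mdist (C_metric X) (\<phi> U f) f) \<longlongrightarrow> 0) (net_filter \<Lambda> le)"
    by (rule net_determined_any_index[OF det dir, where \<phi> = \<phi>]) (use \<phi>_pos conv f in auto)
  then have lim: "uniform_limit (topspace X) (\<lambda>U. \<phi> U f) f (net_filter \<Lambda> le)"
    using \<phi>_lim[OF f] by simp
  show "T f = f x"
  proof (rule eq_if_norm_le_all)
    fix e :: real assume "0 < e"
    then obtain U where U: "U \<in> \<Lambda>" "\<And>V z. V \<in> \<Lambda> \<Longrightarrow> le U V \<Longrightarrow> z \<in> topspace X \<Longrightarrow> dist (\<phi> V f z) (f z) < e"
      using uniform_limitD[OF lim] unfolding eventually_net_filter[OF dir] by blast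
    have "dist (\<phi> U f x) (f x) < e" using U x by (auto simp: le_def)
    moreover have "\<phi> U f x = T f" using h(3)[OF U(1)] x by (simp add: \<phi>_def)
    ultimately show "cmod (T f - f x) \<le> e" by (simp add: dist_norm)
  qed
qed

text \<open>Over a one-point space a positive map is a positive functional.  A state that agrees with evaluation at
  \<open>x\<close> on \<open>G\<close> is a constant net converging on \<open>G\<close>, hence everywhere.\<close>

lemma net_determined_point_imp_unique_extension:
  assumes X: "compact_space X" and G: "G \<subseteq> C_fun X" "G \<subseteq> A" and x: "x \<in> topspace X"
    and Y: "topspace Y = {y}" "compact_space Y"
    and det: "net_determined X Y (\<lambda>f. C_const Y (f x)) G"
  shows "unique_extension X A x"
  unfolding unique_extension_def
proof (intro ballI impI)
  interpret C: function_system X "C_fun X" by (rule function_system_C_fun[OF X])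
  fix T f assume T: "T \<in> state_space X (C_fun X)" and eval: "\<forall>a\<in>A. T a = a x" and f: "f \<in> C_fun X"
  have pos: "positive_functional X (C_fun X) T" using T by (simp add: state_space_iff)
  define \<phi> where "\<phi> i g = C_const Y (T g)" for i :: unit and g
  define le where "le i j \<longleftrightarrow> True" for i j :: unit
  have dir: "directed_set UNIV le"
    by (auto simp: directed_set_def le_def intro!: reflp_onI transp_onI)
  have mem: "C_const Y c \<in> C_fun Y" for c by (rule C_const_mem[OF Y(2)])
  have "positive_linear_C X Y (\<phi> i)" for i
    unfolding positive_linear_C_def linear_C_def
    using mem positive_functionalD[OF pos]
    by (auto simp: \<phi>_def C_nonneg_def C_apply intro!: C_eqI[of _ Y])
  moreover have "((\<lambda>i. mdist (C_metric Y) (\<phi> i g) (C_const Y (g x))) \<longlongrightarrow> 0) (net_filter UNIV le)"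
    if "g \<in> G" for g
  proof -
    have "T g = g x" using that G eval by auto
    then show ?thesis
      using tendsto_C_metric_iff_uniform_limit[of "\<lambda>i. \<phi> i g" Y "net_filter UNIV le" "C_const Y (g x)"] mem
      by (simp add: \<phi>_def uniform_limit_iff)
  qed
  ultimately have "((\<lambda>i. mdist (C_metric Y) (\<phi> i f) (C_const Y (f x))) \<longlongrightarrow> 0) (net_filter UNIV le)"
    using net_determined_any_index[OF det dir _ _ f] by blast
  then have lim: "uniform_limit (topspace Y) (\<lambda>i. \<phi> i f) (C_const Y (f x)) (net_filter UNIV le)"
    using tendsto_C_metric_iff_uniform_limit[of "\<lambda>i. \<phi> i f" Y "net_filter UNIV le" "C_const Y (f x)"] mem
    by (simp add: \<phi>_def)
  show "T f = f x"
  proof (rule eq_if_norm_le_all)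
    fix e :: real assume "0 < e"
    then have "dist (T f) (f x) < e"
      using uniform_limitD[OF lim] unfolding eventually_net_filter[OF dir]
      by (auto simp: le_def \<phi>_def Y C_apply)
    then show "cmod (T f - f x) \<le> e" by (simp add: dist_norm)
  qed
qed

text \<open>For the implication from the last condition to the first, one-point spaces suffice, and these exist over
  every type of points.\<close>

theorem theorem5p3:
  fixes X :: "'a topology" and G A :: "('a \<Rightarrow> complex) set"
  assumes "compact_space X" and "Hausdorff_space X"
    and "G \<subseteq> C_fun X" and "C_const X 1 \<in> G"
    and "A = spanned_function_system X G"
    and "generates_C X A"
  shows "(choquet_boundary X A = topspace X \<longleftrightarrow> korovkin_set X G) \<and>
    (korovkin_set X G \<longleftrightarrow>
      (\<forall>(Y :: 'b topology) \<pi>.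
         compact_space Y \<and> Hausdorff_space Y \<and> unital_star_hom X Y \<pi> \<longrightarrow>
         net_determined X Y \<pi> G))"
proof -
  let ?L = "lin_span X (G \<union> C_star X ` G)"
  interpret C: function_system X "C_fun X" by (rule function_system_C_fun[OF assms(1)])
  interpret L: function_system X ?L
    by (rule function_system_lin_span[OF assms(1,3,4)])
  have A_eq: "A = mtopology_of (C_metric X) closure_of ?L"
    using assms(5) by (simp add: spanned_function_system_def closed_lin_span_def)
  interpret A: function_system X A
    unfolding A_eq by (rule L.function_system_closure)
  have "?L \<subseteq> A"
    using L.subset_C_fun unfolding A_eq C_fun_def
    by (intro closure_of_subset) simp
  moreover have "G \<subseteq> ?L"
    using lin_span_superset[of "G \<union> C_star X ` G" X] assms(3) C.star_mem by blast
  ultimately have GA: "G \<subseteq> A" by blast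
  have hom_id: "unital_star_hom X X (\<lambda>f. f)"
    by (simp add: unital_star_hom_def linear_C_def)

  have one_imp: "net_determined X Y \<pi> G"
    if "choquet_boundary X A = topspace X" "unital_star_hom X Y \<pi>" for Y :: "'c topology" and \<pi>
  proof (rule unique_extension_imp_net_determined[OF assms(1,3,4) _ that(2)])
    fix x assume "x \<in> topspace X"
    then show "unique_extension X ?L x"
      using A.choquet_boundary_imp_unique_extension[OF assms(6)] that(1)
        L.unique_extension_of_closure by (simp add: A_eq)
  qed
  have imp_one: "choquet_boundary X A = topspace X"
    if "\<And>x. x \<in> topspace X \<Longrightarrow> unique_extension X A x"
    using A.unique_extension_imp_choquet_boundary[OF that] by (auto simp: choquet_boundary_def)

  have "korovkin_set X G" if "choquet_boundary X A = topspace X"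
    using one_imp[OF that hom_id] assms(3,4) by (simp add: korovkin_set_def)
  moreover have "choquet_boundary X A = topspace X" if "korovkin_set X G"
    using that net_determined_identity_imp_unique_extension[OF assms(1-3) GA]
    by (intro imp_one) (auto simp: korovkin_set_def)
  moreover have "choquet_boundary X A = topspace X"
    if three: "\<forall>(Y :: 'b topology) \<pi>. compact_space Y \<and> Hausdorff_space Y \<and> unital_star_hom X Y \<pi> \<longrightarrow>
         net_determined X Y \<pi> G"
  proof (rule imp_one)
    fix x assume x: "x \<in> topspace X"
    define Y :: "'b topology" where "Y = discrete_topology {undefined}"
    have Y: "topspace Y = {undefined}" "compact_space Y" "Hausdorff_space Y"
      by (auto simp: Y_def compact_space_discrete_topology Hausdorff_space_discrete_topology)
    have "unital_star_hom X Y (\<lambda>f. C_const Y (f x))"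
      unfolding unital_star_hom_def linear_C_def using x C_const_mem[OF Y(2)]
      by (auto simp: C_apply intro!: C_eqI[of _ Y])
    then have "net_determined X Y (\<lambda>f. C_const Y (f x)) G" using three Y by blast
    then show "unique_extension X A x"
      using net_determined_point_imp_unique_extension[OF assms(1,3) GA x Y(1,2)] by blast
  qed
  ultimately show ?thesis using one_imp by blast
qed

end
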